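(* Let $\mu$ be an AMS measure on $(\mathbb{X}^{\mathbb{Z}},\mathcal{X}^{\mathbb{Z}})$ and let $f:\mathbb{X}\to\mathbb{Y}^*$ be such that the expansion rate $\bar l(x^{\mathbb{Z}})=\lim_{n\to\infty}S(x^{\mathbb{Z}},n)/n$ is $\mu$-almost surely in the range $(0,\infty)$. Then $\nu=\mu\circ(f^{\mathbb{Z}})^{-1}$ is an AMS measure on $(\mathbb{Y}^{\mathbb{Z}},\mathcal{Y}^{\mathbb{Z}})$ with the stationary mean given, for every $A\in\mathcal{Y}^{\mathbb{Z}}$, by $$\bar\nu(A)=\int\left[\lim_{n\to\infty}\frac{1}{S(x^{\mathbb{Z}},n)}\sum_{k=0}^{S(x^{\mathbb{Z}},n)-1}F(A,k,x^{\mathbb{Z}})\right]d\mu(x^{\mathbb{Z}})$$ $$=\int\left[\bar l(x^{\mathbb{Z}})\right]^{-1}\left[\lim_{n\to\infty}\frac1n\sum_{i=0}^{n-1}G(A,T^ix^{\mathbb{Z}})\right]d\mu(x^{\mathbb{Z}})$$ $$=\int\left[\bar l(x^{\mathbb{Z}})\right]^{-1}\left[\lim_{n\to\infty}\frac1n\sum_{i=0}^{n-1}G(A,T^ix^{\mathbb{Z}})\right]d\bar\mu(x^{\mathbb{Z}}).$$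
   Context: $\mathbb{X},\mathbb{Y}$ are countable sets; $\mathbb{Y}^*$ is the set of finite strings over $\mathbb{Y}$ including the empty string $\lambda$; $|w|$ is string length. $(\mathbb{X}^{\mathbb{Z}},\mathcal{X}^{\mathbb{Z}})$ and $(\mathbb{Y}^{\mathbb{Z}},\mathcal{Y}^{\mathbb{Z}})$ are the spaces of two-sided sequences with product $\sigma$-algebras; "measure" means probability measure. $T$ denotes the shift $T((x_i)_{i\in\mathbb{Z}})=(x_{i+1})_{i\in\mathbb{Z}}$ on either space. A measure $\mu$ is asymptotically mean stationary (AMS) if $\bar\mu(A)=\lim_{n\to\infty}\frac1n\sum_{i=0}^{n-1}\mu(T^{-i}A)$ exists for every measurable $A$; $\bar\mu$ is then a stationary probability measure called the stationary mean of $\mu$. For $f:\mathbb{X}\to\mathbb{Y}^*$, $f^{\mathbb{Z}}(x^{\mathbb{Z}})=\dots f(x_{-1})f(x_0)\mathbf{.}f(x_1)f(x_2)\dots$ is the two-sided concatenation ($f(x_1)$ starts at coordinate $1$), which lies in $\mathbb{Y}^{\mathbb{Z}}$ when infinitely many of the $f(x_i)$, both for $i\ge1$ and for $i\le0$, are nonempty. That $\nu=\mu\circ(f^{\mathbb{Z}})^{-1}$ is a measure on $\mathbb{Y}^{\mathbb{Z}}$ includes that $f^{\mathbb{Z}}(x^{\mathbb{Z}})\in\mathbb{Y}^{\mathbb{Z}}$ for $\mu$-almost all $x^{\mathbb{Z}}$. Notation: $S(x^{\mathbb{Z}},n)=\sum_{i=1}^n|f(x_i)|$; the limit $\bar l$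 exists in $[0,\infty]$ $\mu$- and $\bar\mu$-almost everywhere for AMS $\mu$. $F(A,k,x^{\mathbb{Z}})=\mathbf{1}_{\{T^kf^{\mathbb{Z}}(x^{\mathbb{Z}})\in A\}}$ (indicator), and $G(A,x^{\mathbb{Z}})=\sum_{k=0}^{|f(x_1)|-1}F(A,k,x^{\mathbb{Z}})$, with the empty sum $\sum_{k=0}^{-1}$ equal to $0$. *)

theory Defs
  imports "HOL-Probability.Probability"
begin

definition seq_space :: "(int \<Rightarrow> 'a) measure" where
  "seq_space = Pi\<^sub>M UNIV (\<lambda>_. count_space UNIV)"

definition shift :: "(int \<Rightarrow> 'a) \<Rightarrow> int \<Rightarrow> 'a" where
  "shift x = (\<lambda>i. x (i + 1))"

definition shift_avg :: "(int \<Rightarrow> 'a) measure \<Rightarrow> (int \<Rightarrow> 'a) set \<Rightarrow> nat \<Rightarrow> real" where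
  "shift_avg M A n = (\<Sum>i<n. measure M ((shift ^^ i) -` A)) / real n"

definition AMS :: "(int \<Rightarrow> 'a) measure \<Rightarrow> bool" where
  "AMS M \<longleftrightarrow> prob_space M \<and> sets M = sets seq_space \<and>
     (\<forall>A\<in>sets seq_space. convergent (shift_avg M A))"

text \<open>For an AMS measure the set function below is countably additive by the
  Vitali--Hahn--Saks theorem, so the value of the measure on a measurable set is the limit of
  the averages.\<close>

definition stationary_mean :: "(int \<Rightarrow> 'a) measure \<Rightarrow> (int \<Rightarrow> 'a) measure" where
  "stationary_mean M = measure_of UNIV (sets seq_space) (\<lambda>A. ennreal (lim (shift_avg M A)))"

text \<open>The sequences whose concatenation is infinite in both directions.\<close>

definition expandable :: "('x \<Rightarrow> 'y list) \<Rightarrow> (int \<Rightarrow> 'x) set" where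
  "expandable f = {x. infinite {i. 1 \<le> i \<and> f (x i) \<noteq> []} \<and> infinite {i. i \<le> 0 \<and> f (x i) \<noteq> []}}"

text \<open>The coordinate at which the block \<open>f (x i)\<close> starts; at most one of the two sums is
  nonempty, and the block of \<open>x 1\<close> starts at coordinate 1.\<close>

definition block_start :: "('x \<Rightarrow> 'y list) \<Rightarrow> (int \<Rightarrow> 'x) \<Rightarrow> int \<Rightarrow> int" where
  "block_start f x i =
     1 + (\<Sum>j\<in>{1..<i}. int (length (f (x j)))) - (\<Sum>j\<in>{i..<1}. int (length (f (x j))))"

text \<open>The two-sided concatenation. The value outside \<^term>\<open>expandable f\<close> is a dummy. On that
  set, every coordinate \<open>k\<close> lies in exactly one (necessarily nonempty) block.\<close>

definition expand :: "('x \<Rightarrow> 'y list) \<Rightarrow> (int \<Rightarrow> 'x) \<Rightarrow> int \<Rightarrow> 'y" where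
  "expand f x =
     (if x \<in> expandable f
      then (\<lambda>k. let i = (THE i. block_start f x i \<le> k \<and> k < block_start f x (i + 1))
                in f (x i) ! nat (k - block_start f x i))
      else (\<lambda>_. undefined))"

definition S :: "('x \<Rightarrow> 'y list) \<Rightarrow> (int \<Rightarrow> 'x) \<Rightarrow> nat \<Rightarrow> nat" where
  "S f x n = (\<Sum>i=1..n. length (f (x (int i))))"

text \<open>Real-valued, hence meaningful only where the limit exists and is finite.\<close>

definition expansion_rate :: "('x \<Rightarrow> 'y list) \<Rightarrow> (int \<Rightarrow> 'x) \<Rightarrow> real" where
  "expansion_rate f x = lim (\<lambda>n. real (S f x n) / real n)"

definition rate_pos_finite :: "('x \<Rightarrow> 'y list) \<Rightarrow> (int \<Rightarrow> 'x) \<Rightarrow> bool" where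
  "rate_pos_finite f x \<longleftrightarrow>
     convergent (\<lambda>n. real (S f x n) / real n) \<and> 0 < expansion_rate f x"

definition F :: "('x \<Rightarrow> 'y list) \<Rightarrow> (int \<Rightarrow> 'y) set \<Rightarrow> nat \<Rightarrow> (int \<Rightarrow> 'x) \<Rightarrow> real" where
  "F f A k x = indicator A ((shift ^^ k) (expand f x))"

definition G :: "('x \<Rightarrow> 'y list) \<Rightarrow> (int \<Rightarrow> 'y) set \<Rightarrow> (int \<Rightarrow> 'x) \<Rightarrow> real" where
  "G f A x = (\<Sum>k<length (f (x 1)). F f A k x)"

definition F_avg :: "('x \<Rightarrow> 'y list) \<Rightarrow> (int \<Rightarrow> 'y) set \<Rightarrow> (int \<Rightarrow> 'x) \<Rightarrow> nat \<Rightarrow> real" where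
  "F_avg f A x n = (\<Sum>k<S f x n. F f A k x) / real (S f x n)"

definition G_avg :: "('x \<Rightarrow> 'y list) \<Rightarrow> (int \<Rightarrow> 'y) set \<Rightarrow> (int \<Rightarrow> 'x) \<Rightarrow> nat \<Rightarrow> real" where
  "G_avg f A x n = (\<Sum>i<n. G f A ((shift ^^ i) x)) / real n"

end

theory Submission
  imports Defs
begin

text \<open>
  Let \<open>m\<close> be the stationary mean of \<open>\<mu>\<close>. Shift-invariant sets have the same probability under \<open>\<mu>\<close> and \<open>m\<close>, so
  invariant events and integrals of invariant functions may be treated under \<open>m\<close>, where the ergodic
  theorem is available. That \<open>m\<close> is a measure at all is Nikodym's convergence theorem
  (\<open>additive_limit_continuous_at_empty\<close>).

  The concatenation intertwines the shifts: the output of \<open>T\<^sup>n x\<close> is the output of \<open>x\<close> shifted by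
  \<open>S(x, n)\<close> (\<open>expand_shift_funpow\<close>). Hence the sum of \<open>F\<close> over the first \<open>S(x, n)\<close> output coordinates is the sum of
  \<open>G\<close> over the first \<open>n\<close> points of the orbit of \<open>x\<close> (\<open>sum_F_eq_sum_G\<close>), and the \<open>F\<close>-averages are quotients of ergodic
  averages of \<open>G\<close> and of the block length \<open>|f(x\<^sub>1)|\<close>.

  The averages of the block length converge to a finite limit by hypothesis, but the block length
  need not be integrable. The ergodic theorem is therefore proved in the following form
  (\<open>dominated_ergodic_theorem\<close>): if \<open>0 \<le> h \<le> g\<close> and the averages of \<open>g\<close> are almost surely bounded, then the
  averages of \<open>h\<close> converge almost surely. The maximal ergodic theorem shows that \<open>g\<close> is integrable over the
  invariant sets on which its averages have an upper limit below a constant, and Birkhoff's argument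
  works on each of these.

  It follows that the \<open>F\<close>-averages converge along \<open>S(x, n)\<close> almost surely. As \<open>S(x, n)\<close> grows linearly and \<open>F\<close> is
  bounded, they converge along all integers (\<open>averages_along_linear_subsequence\<close>). Integration with
  dominated convergence gives the limits that define the stationary mean of \<open>\<nu>\<close>, and the
  first formula. The integrand equals \<open>1 / l\<close> times the limit of the \<open>G\<close>-averages, where \<open>l\<close> is the
  expansion rate. This expression is invariant, so its integrals under \<open>\<mu>\<close> and \<open>m\<close> agree.

  Finally, the output is two-sided infinite because a stationary process almost surely has no first
  nonempty block (\<open>recurrence_backwards\<close>).
\<close>

section \<open>Pointwise limits of measures\<close>

text \<open>Nikodym's convergence theorem, by a gliding hump. Suppose \<open>q (A i)\<close> decreases to \<open>\<delta> > 0\<close>. One picks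
  indices alternately: a \<open>k\<close> so large that \<open>p k\<close> is close to \<open>q\<close> on the current \<open>A n\<close>, then an \<open>n\<close> so large
  that this \<open>p k\<close> nearly vanishes on the next \<open>A n\<close>. Each chosen \<open>p k\<close> then has most of its mass within
  \<open>A n0\<close> on one of the disjoint differences of consecutive sets. On the union of every second difference
  the values \<open>p k\<close> oscillate between a large and a small value, so they cannot converge.\<close>

lemma (in sigma_algebra) additive_limit_continuous_at_empty:
  fixes p :: "nat \<Rightarrow> 'a set \<Rightarrow> real" and q :: "'a set \<Rightarrow> real"
  assumes nonneg: "\<And>k B. B \<in> M \<Longrightarrow> 0 \<le> p k B"
    and add: "\<And>k B C. B \<in> M \<Longrightarrow> C \<in> M \<Longrightarrow> B \<inter> C = {} \<Longrightarrow> p k (B \<union> C) = p k B + p k C"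
    and cont: "\<And>k B. range B \<subseteq> M \<Longrightarrow> decseq B \<Longrightarrow> (\<Inter>i. B i) = {} \<Longrightarrow> (\<lambda>i::nat. p k (B i)) \<longlonglongrightarrow> 0"
    and lim: "\<And>B. B \<in> M \<Longrightarrow> (\<lambda>k. p k B) \<longlonglongrightarrow> q B"
    and A: "range A \<subseteq> M" "decseq A" "(\<Inter>i::nat. A i) = {}"
  shows "(\<lambda>i. q (A i)) \<longlonglongrightarrow> 0"
proof -
  have AM: "A i \<in> M" for i using A(1) by auto
  have p_diff: "p k (C - B) = p k C - p k B" if "B \<in> M" "C \<in> M" "B \<subseteq> C" for k B C
    using add[of B "C - B" k] that by (simp add: Un_absorb1 Diff)
  have p_mono: "p k B \<le> p k C" if "B \<in> M" "C \<in> M" "B \<subseteq> C" for k B C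
    using p_diff[OF that, of k] nonneg[of "C - B" k] that by (simp add: Diff)
  have p_Un: "p k (B \<union> C) \<le> p k B + p k C" if "B \<in> M" "C \<in> M" for k B C
    using add[of B "C - B" k] p_mono[of "C - B" C k] that by (simp add: Diff)
  have q_nonneg: "0 \<le> q B" if "B \<in> M" for B
    using LIMSEQ_le_const[OF lim[OF that]] nonneg[OF that] by blast
  have q_mono: "q B \<le> q C" if "B \<in> M" "C \<in> M" "B \<subseteq> C" for B C
    using LIMSEQ_le[OF lim lim] p_mono[OF that] that by blast
  have q_diff: "q (C - B) = q C - q B" if "B \<in> M" "C \<in> M" "B \<subseteq> C" for B C
  proof (rule LIMSEQ_unique[OF lim])
    show "C - B \<in> M" using that by (simp add: Diff)
    show "(\<lambda>k. p k (C - B)) \<longlonglongrightarrow> q C - q B"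
      unfolding p_diff[OF that] by (intro tendsto_diff lim that)
  qed
  have sub: "A j \<subseteq> A i" if "i \<le> j" for i j using A(2) that by (simp add: decseq_def)
  have dec: "decseq (\<lambda>i. q (A i))"
    unfolding decseq_def by (intro allI impI q_mono AM sub)
  obtain \<delta> where \<delta>: "(\<lambda>i. q (A i)) \<longlonglongrightarrow> \<delta>" "\<And>i. \<delta> \<le> q (A i)"
    using decseq_convergent[OF dec] q_nonneg[OF AM] by metis
  have "\<delta> \<ge> 0" using LIMSEQ_le_const[OF \<delta>(1)] q_nonneg[OF AM] by blast
  have "\<not> \<delta> > 0"
  proof
    assume pos: "\<delta> > 0"
    \<comment> \<open>Starting where \<open>q\<close> has almost reached its limit leaves little mass in \<open>A n0 - A n\<close> for all later \<open>n\<close>.\<close>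
    obtain n0 where n0: "q (A n0) < \<delta> + \<delta> / 8"
      using order_tendstoD(2)[OF \<delta>(1), of "\<delta> + \<delta> / 8"] pos
      by (auto simp: eventually_sequentially)
    define good where "good = (\<lambda>(n, k). n0 \<le> n \<and> 7 * \<delta> / 8 < p k (A n) \<and> p k (A n0 - A n) < \<delta> / 4)"
    define nxt where "nxt = (\<lambda>(n, k) (n', k'). n < n' \<and> k < k' \<and> p k (A n') < \<delta> / 8)"
    have ex: "\<exists>k>K. good (n, k)" if n: "n0 \<le> n" for n K
    proof -
      have "q (A n0 - A n) < \<delta> / 4" "7 * \<delta> / 8 < q (A n)"
        using n0 \<delta>(2)[of n] pos q_diff[OF AM AM sub[OF n]] by auto
      then have "\<forall>\<^sub>F k in sequentially. 7 * \<delta> / 8 < p k (A n)"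
        "\<forall>\<^sub>F k in sequentially. p k (A n0 - A n) < \<delta> / 4"
        using order_tendstoD(1)[OF lim[OF AM]] order_tendstoD(2)[OF lim[OF Diff[OF AM AM]]] by blast+
      then have "\<forall>\<^sub>F k in sequentially. k > K \<and> good (n, k)"
        using eventually_gt_at_top[of K] by eventually_elim (auto simp: good_def n)
      then show ?thesis by (auto simp: eventually_sequentially)
    qed
    have ex2: "\<exists>n'>n. p k (A n') < \<delta> / 8" for n k
    proof -
      have "\<forall>\<^sub>F n' in sequentially. p k (A n') < \<delta> / 8"
        using order_tendstoD(2)[OF cont[OF A, of k], of "\<delta> / 8"] pos by simp
      then have "\<forall>\<^sub>F n' in sequentially. n' > n \<and> p k (A n') < \<delta> / 8"
        using eventually_gt_at_top[of n] by eventually_elim simp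
      then show ?thesis by (auto simp: eventually_sequentially)
    qed
    have "\<exists>s. \<forall>j::nat. good (s j) \<and> nxt (s j) (s (Suc j))"
    proof (rule dependent_nat_choice)
      show "\<exists>x. good x" using ex[of n0 0] by blast
    next
      fix x and j :: nat assume "good x"
      obtain n k where x: "x = (n, k)" by force
      obtain n' where n': "n' > n" "p k (A n') < \<delta> / 8" using ex2 by blast
      then obtain k' where "k' > k" "good (n', k')"
        using ex[of n' k] \<open>good x\<close> by (auto simp: x good_def)
      then show "\<exists>y. good y \<and> nxt x y" using n' by (auto simp: x nxt_def intro!: exI[of _ "(n', k')"])
    qed
    then obtain s where s: "\<And>j. good (s j)" "\<And>j. nxt (s j) (s (Suc j))" by blast
    define N where "N j = fst (s j)" for j
    define K where "K j = snd (s j)" for j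
    have N0: "n0 \<le> N j" and big: "7 * \<delta> / 8 < p (K j) (A (N j))"
      and small: "p (K j) (A n0 - A (N j)) < \<delta> / 4" for j
      using s(1)[of j] by (auto simp: good_def N_def K_def split: prod.splits)
    have N_Suc: "N j < N (Suc j)" and K_Suc: "K j < K (Suc j)"
      and tail: "p (K j) (A (N (Suc j))) < \<delta> / 8" for j
      using s(2)[of j] by (auto simp: nxt_def N_def K_def split: prod.splits)
    have N_mono: "N i \<le> N j" if "i \<le> j" for i j
      using lift_Suc_mono_le[of N i j] N_Suc that less_imp_le by blast
    have K_mono: "strict_mono K" using K_Suc by (simp add: strict_mono_Suc_iff)
    define B where "B = (\<Union>j. A (N (2 * j)) - A (N (Suc (2 * j))))"
    have BM: "B \<in> M" unfolding B_def using AM by auto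
    have even: "6 * \<delta> / 8 \<le> p (K (2 * j)) B" for j
    proof -
      have "p (K (2 * j)) (A (N (2 * j)) - A (N (Suc (2 * j)))) \<le> p (K (2 * j)) B"
        by (rule p_mono) (use AM BM in \<open>auto simp: B_def\<close>)
      then show ?thesis
        using p_diff[OF AM AM sub[OF less_imp_le[OF N_Suc]], of "K (2 * j)" "2 * j"]
          big[of "2 * j"] tail[of "2 * j"] by linarith
    qed
    have odd: "p (K (Suc (2 * j))) B \<le> 3 * \<delta> / 8" for j
    proof -
      have "A (N (2 * i)) - A (N (Suc (2 * i))) \<subseteq> (A n0 - A (N (Suc (2 * j)))) \<union> A (N (Suc (Suc (2 * j))))" for i
      proof (cases "i \<le> j")
        case True
        then show ?thesis using sub[OF N0[of "2 * i"]] sub[OF N_mono[of "Suc (2 * i)" "Suc (2 * j)"]] by auto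
      next
        case False
        then have "Suc (Suc (2 * j)) \<le> 2 * i" by simp
        then show ?thesis using sub[OF N_mono] by blast
      qed
      then have "B \<subseteq> (A n0 - A (N (Suc (2 * j)))) \<union> A (N (Suc (Suc (2 * j))))"
        unfolding B_def by blast
      then have "p (K (Suc (2 * j))) B
          \<le> p (K (Suc (2 * j))) ((A n0 - A (N (Suc (2 * j)))) \<union> A (N (Suc (Suc (2 * j)))))"
        using BM AM by (intro p_mono) auto
      also have "\<dots> \<le> p (K (Suc (2 * j))) (A n0 - A (N (Suc (2 * j)))) + p (K (Suc (2 * j))) (A (N (Suc (Suc (2 * j)))))"
        using AM by (intro p_Un) auto
      finally show ?thesis using small[of "Suc (2 * j)"] tail[of "Suc (2 * j)"] by simp
    qed
    have "strict_mono (\<lambda>j. K (2 * j))" "strict_mono (\<lambda>j. K (Suc (2 * j)))"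
      using K_mono by (auto simp: strict_mono_def)
    then have "(\<lambda>j. p (K (2 * j)) B) \<longlonglongrightarrow> q B" "(\<lambda>j. p (K (Suc (2 * j))) B) \<longlonglongrightarrow> q B"
      using LIMSEQ_subseq_LIMSEQ[OF lim[OF BM]] by (auto simp: o_def)
    note this(1)[THEN LIMSEQ_le_const, of "6 * \<delta> / 8"] this(2)[THEN LIMSEQ_le_const2, of "3 * \<delta> / 8"]
    then have "6 * \<delta> / 8 \<le> q B" "q B \<le> 3 * \<delta> / 8"
      using even odd by simp_all
    then show False using pos by simp
  qed
  then show ?thesis using \<delta>(1) \<open>\<delta> \<ge> 0\<close> by simp
qed

section \<open>The ergodic theorem\<close>

definition time_avg :: "('a \<Rightarrow> 'a) \<Rightarrow> ('a \<Rightarrow> real) \<Rightarrow> 'a \<Rightarrow> nat \<Rightarrow> real" where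
  "time_avg T h x n = (\<Sum>i<n. h ((T ^^ i) x)) / real n"

lemma time_avg_step:
  "time_avg T h (T x) n = real (Suc n) / real n * time_avg T h x (Suc n) - h x / real n"
proof -
  have "(\<Sum>i<Suc n. h ((T ^^ i) x)) = h x + (\<Sum>i<n. h ((T ^^ i) (T x)))"
    by (simp add: sum.lessThan_Suc_shift funpow_Suc_right del: funpow.simps sum.lessThan_Suc)
  then have "time_avg T h x (Suc n) = (h x + (\<Sum>i<n. h ((T ^^ i) (T x)))) / real (Suc n)"
    unfolding time_avg_def by (rule arg_cong)
  then have "real (Suc n) * time_avg T h x (Suc n) = h x + (\<Sum>i<n. h ((T ^^ i) (T x)))"
    by (simp del: of_nat_Suc)
  then show ?thesis
    by (simp add: time_avg_def[of T h "T x"] diff_divide_distrib[symmetric] del: of_nat_Suc)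
qed

text \<open>As the equivalence holds for every \<open>L\<close>, the term \<open>lim (time_avg T h x)\<close> is exactly invariant under
  \<open>T\<close>, including at points of divergence, where it is a default value.\<close>

lemma time_avg_tendsto_step: "time_avg T h (T x) \<longlonglongrightarrow> L \<longleftrightarrow> time_avg T h x \<longlonglongrightarrow> L"
proof -
  have r: "(\<lambda>n. real (Suc n) / real n) \<longlonglongrightarrow> 1" and r': "(\<lambda>n. real n / real (Suc n)) \<longlonglongrightarrow> 1"
    and c: "(\<lambda>n. h x / real n) \<longlonglongrightarrow> 0" and c': "(\<lambda>n. h x / real (Suc n)) \<longlonglongrightarrow> 0"
    by real_asymp+
  show ?thesis
  proof
    assume L: "time_avg T h x \<longlonglongrightarrow> L"
    show "time_avg T h (T x) \<longlonglongrightarrow> L"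
      using tendsto_diff[OF tendsto_mult[OF r LIMSEQ_Suc[OF L]] c]
      unfolding time_avg_step[abs_def, symmetric]
      by (simp add: time_avg_step[symmetric] del: of_nat_Suc)
  next
    assume L: "time_avg T h (T x) \<longlonglongrightarrow> L"
    have "(\<lambda>n. real n / real (Suc n) * time_avg T h (T x) n + h x / real (Suc n)) \<longlonglongrightarrow> 1 * L + 0"
      by (intro tendsto_intros r' c' L)
    moreover have "\<forall>\<^sub>F n in sequentially. real n / real (Suc n) * time_avg T h (T x) n + h x / real (Suc n)
        = time_avg T h x (Suc n)"
      using eventually_gt_at_top[of 0]
      by eventually_elim (simp add: time_avg_step field_simps del: of_nat_Suc)
    ultimately have "(\<lambda>n. time_avg T h x (Suc n)) \<longlonglongrightarrow> L" by (simp add: filterlim_cong)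
    then show "time_avg T h x \<longlonglongrightarrow> L" by (simp add: filterlim_sequentially_Suc)
  qed
qed

lemma
  shows limsup_time_avg_step: "limsup (\<lambda>n. ereal (time_avg T h (T x) n)) = limsup (\<lambda>n. ereal (time_avg T h x n))"
    and liminf_time_avg_step: "liminf (\<lambda>n. ereal (time_avg T h (T x) n)) = liminf (\<lambda>n. ereal (time_avg T h x n))"
proof -
  have r: "(\<lambda>n. ereal (real (Suc n) / real n)) \<longlonglongrightarrow> ereal 1" and c: "(\<lambda>n. ereal (- h x / real n)) \<longlonglongrightarrow> ereal 0"
    by (intro tendsto_ereal; real_asymp)+
  have eq: "ereal (time_avg T h (T x) n) = ereal (- h x / real n)
      + ereal (real (Suc n) / real n) * ereal (time_avg T h x (n + 1))" for n
    by (simp add: time_avg_step)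
  show "limsup (\<lambda>n. ereal (time_avg T h (T x) n)) = limsup (\<lambda>n. ereal (time_avg T h x n))"
    unfolding eq using limsup_shift[of "\<lambda>n. ereal (time_avg T h x n)"]
    by (subst ereal_limsup_lim_add[OF c], simp, subst ereal_limsup_lim_mult[OF r]) (auto simp flip: zero_ereal_def one_ereal_def)
  show "liminf (\<lambda>n. ereal (time_avg T h (T x) n)) = liminf (\<lambda>n. ereal (time_avg T h x n))"
    unfolding eq using liminf_shift[of "\<lambda>n. ereal (time_avg T h x n)"]
    by (subst ereal_liminf_lim_add[OF c], simp, subst ereal_liminf_lim_mult[OF r]) (auto simp flip: zero_ereal_def one_ereal_def)
qed

lemma convergent_measurable [measurable (raw)]:
  fixes u :: "nat \<Rightarrow> 'a \<Rightarrow> real"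
  assumes [measurable]: "\<And>n. u n \<in> borel_measurable M"
  shows "Measurable.pred M (\<lambda>x. convergent (\<lambda>n. u n x))"
proof -
  have "{x \<in> space M. Cauchy (\<lambda>n. u n x)} \<in> sets M" by measurable
  then show ?thesis by (simp add: pred_def Cauchy_convergent_iff)
qed

locale measure_preserving_system = prob_space M for M :: "'a measure" +
  fixes T :: "'a \<Rightarrow> 'a"
  assumes T_measurable [measurable]: "T \<in> measurable M M"
    and T_preserving: "distr M M T = M"
begin

lemma funpow_measurable [measurable]: "(T ^^ n) \<in> measurable M M"
  by (induction n) (simp_all add: measurable_comp[OF _ T_measurable])

lemma time_avg_measurable [measurable]:
  assumes [measurable]: "h \<in> borel_measurable M"
  shows "(\<lambda>x. time_avg T h x n) \<in> borel_measurable M"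
  unfolding time_avg_def by measurable

lemma integrable_T: "integrable M h \<Longrightarrow> integrable M (\<lambda>x. h (T x))" for h :: "'a \<Rightarrow> real"
  using integrable_distr[OF T_measurable, of h] by (simp add: T_preserving)

lemma integral_T: "h \<in> borel_measurable M \<Longrightarrow> (\<integral>x. h (T x) \<partial>M) = (\<integral>x. h x \<partial>M)" for h :: "'a \<Rightarrow> real"
  using integral_distr[OF T_measurable, of h] by (simp add: T_preserving)

lemma prob_vimage: "A \<in> sets M \<Longrightarrow> prob (T -` A \<inter> space M) = prob A"
  using measure_distr[OF T_measurable, of A] by (simp add: T_preserving)

text \<open>Garsia's argument. Let \<open>m n x\<close> be the maximum of \<open>0\<close> and the first \<open>n\<close> partial sums of \<open>u = 1\<^sub>B h\<close> along the
  orbit of \<open>x\<close>. Where it is positive, \<open>u x \<ge> m n x - m n (T x)\<close>, and the right-hand side integrates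
  to \<open>0\<close> because \<open>T\<close> preserves the measure. As \<open>n\<close> grows, the sets where \<open>m n\<close> is positive exhaust \<open>B\<close>.\<close>

lemma maximal_ergodic:
  fixes h :: "'a \<Rightarrow> real"
  assumes int: "integrable M (\<lambda>x. indicator B x * h x)"
    and inv: "\<And>x. x \<in> space M \<Longrightarrow> T x \<in> B \<longleftrightarrow> x \<in> B"
    and pos: "\<And>x. x \<in> space M \<Longrightarrow> x \<in> B \<Longrightarrow> \<exists>n. 0 < (\<Sum>i<n. h ((T ^^ i) x))"
  shows "0 \<le> (\<integral>x. indicator B x * h x \<partial>M)"
proof -
  define u where "u x = indicator B x * h x" for x
  have u_int [simp]: "integrable M u" using int by (simp add: u_def[abs_def])
  have [measurable]: "u \<in> borel_measurable M" by (rule borel_measurable_integrable[OF u_int])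
  \<comment> \<open>Satisfies \<open>m (Suc n) x = max 0 (u x + m n (T x))\<close>, the recursion of the maximum of the partial sums.\<close>
  define m where "m = rec_nat (\<lambda>x. 0) (\<lambda>n r x. max 0 (u x + r (T x)))"
  have m0: "m 0 x = 0" and mS: "m (Suc n) x = max 0 (u x + m n (T x))" for n x
    by (simp_all add: m_def)
  have m_int: "integrable M (m n)" for n
  proof (induction n)
    case (Suc n)
    have "m (Suc n) = (\<lambda>x. max 0 (u x + m n (T x)))" by (simp add: mS fun_eq_iff)
    moreover have "integrable M (\<lambda>x. m n (T x))" by (rule integrable_T[OF Suc])
    ultimately show ?case by simp
  qed (simp add: m_def)
  have [measurable]: "m n \<in> borel_measurable M" for n using m_int[of n] by simp
  have m_nonneg: "0 \<le> m n x" for n x by (cases n) (simp_all add: m0 mS)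
  have m_Suc: "m n x \<le> m (Suc n) x" for n x
  proof (induction n arbitrary: x)
    case (Suc n)
    then show ?case by (simp add: mS[of "Suc n"] mS[of n] max.coboundedI2)
  qed (simp add: m0 m_nonneg)
  have m_mono: "m n x \<le> m k x" if "n \<le> k" for n k x
    using lift_Suc_mono_le[of "\<lambda>n. m n x" n k] m_Suc that by blast
  have sum_le: "(\<Sum>i<n. u ((T ^^ i) x)) \<le> m n x" for n x
  proof (induction n arbitrary: x)
    case (Suc n)
    have "(\<Sum>i<Suc n. u ((T ^^ i) x)) = u x + (\<Sum>i<n. u ((T ^^ i) (T x)))"
      by (simp add: sum.lessThan_Suc_shift funpow_Suc_right del: funpow.simps sum.lessThan_Suc)
    also have "\<dots> \<le> u x + m n (T x)" using Suc by simp
    finally show ?case by (simp add: mS)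
  qed (simp add: m0)
  have T_space: "x \<in> space M \<Longrightarrow> (T ^^ i) x \<in> space M" for x i
    using measurable_space[OF funpow_measurable] by blast
  have invi: "(T ^^ i) x \<in> B \<longleftrightarrow> x \<in> B" if "x \<in> space M" for x i
    using that by (induction i) (simp_all add: inv T_space)
  define P where "P n = {x\<in>space M. 0 < m n x}" for n
  have [measurable]: "P n \<in> sets M" for n unfolding P_def by measurable
  have step: "0 \<le> (\<integral>x. u x * indicator (P n) x \<partial>M)" for n
  proof (cases n)
    case 0
    then have "P n = {}" by (simp add: P_def m0)
    then show ?thesis by simp
  next
    case (Suc k)
    have "0 = (\<integral>x. m n x - m n (T x) \<partial>M)"
      using m_int integrable_T[OF m_int[of n]] integral_T[of "m n"] by (subst Bochner_Integration.integral_diff) auto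
    also have "\<dots> \<le> (\<integral>x. u x * indicator (P n) x \<partial>M)"
    proof (rule integral_mono)
      show "integrable M (\<lambda>x. m n x - m n (T x))"
        using m_int integrable_T[OF m_int[of n]] by auto
      show "integrable M (\<lambda>x. u x * indicator (P n) x)"
        by (rule integrable_real_mult_indicator) auto
      fix x assume x: "x \<in> space M"
      show "m n x - m n (T x) \<le> u x * indicator (P n) x"
      proof (cases "0 < m n x")
        case True
        then have "m n x = u x + m k (T x)" by (simp add: Suc mS)
        then show ?thesis using True x m_Suc[of k "T x"] by (simp add: P_def Suc)
      next
        case False
        then show ?thesis using x m_nonneg[of n "T x"] by (simp add: P_def)
      qed
    qed
    finally show ?thesis .
  qed
  have "(\<lambda>n. \<integral>x. u x * indicator (P n) x \<partial>M) \<longlonglongrightarrow> (\<integral>x. u x \<partial>M)"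
  proof (rule integral_dominated_convergence[where w = "\<lambda>x. \<bar>u x\<bar>"])
    show "AE x in M. (\<lambda>n. u x * indicator (P n) x) \<longlonglongrightarrow> u x"
    proof (rule AE_I2)
      fix x assume x: "x \<in> space M"
      show "(\<lambda>n. u x * indicator (P n) x) \<longlonglongrightarrow> u x"
      proof (cases "x \<in> B")
        case False
        then show ?thesis by (simp add: u_def)
      next
        case True
        then obtain n where n: "0 < (\<Sum>i<n. h ((T ^^ i) x))" using pos x by blast
        have "0 < m n x" using n sum_le[of x n] invi[OF x] True by (simp add: u_def)
        have "\<forall>\<^sub>F k in sequentially. u x * indicator (P k) x = u x"
          using eventually_ge_at_top[of n]
          by eventually_elim (use m_mono[of n _ x] x \<open>0 < m n x\<close> in \<open>fastforce simp: P_def\<close>)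
        then show ?thesis by (rule tendsto_eventually)
      qed
    qed
  qed (auto simp: indicator_def)
  then have "0 \<le> (\<integral>x. u x \<partial>M)" using step LIMSEQ_le_const by blast
  then show ?thesis by (simp add: u_def)
qed

text \<open>On \<open>D\<close> the averages of the truncations \<open>min g k\<close> eventually lie below \<open>c\<close>, so the maximal
  ergodic theorem applied to \<open>c - min g k\<close> bounds their integrals over \<open>D\<close> by \<open>\<bar>c\<bar>\<close>, uniformly in \<open>k\<close>.
  This is how a function that need not be integrable globally becomes integrable on invariant pieces.\<close>

lemma integrable_where_limsup_bounded:
  fixes g :: "'a \<Rightarrow> real" and c :: real
  assumes [measurable]: "g \<in> borel_measurable M" and g: "\<And>x. 0 \<le> g x"
  defines "D \<equiv> {x\<in>space M. limsup (\<lambda>n. ereal (time_avg T g x n)) < ereal c}"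
  shows "integrable M (\<lambda>x. indicator D x * g x)"
proof -
  have [measurable]: "D \<in> sets M" unfolding D_def by measurable
  have D_int: "integrable M (indicat_real D)"
    by (rule integrable_const_bound[where B = 1]) auto
  define t where "t k x = indicator D x * min (g x) (real k)" for k x
  have t_int: "integrable M (t k)" for k
    by (rule integrable_const_bound[where B = "real k"])
      (auto simp: t_def[abs_def] indicator_def g)
  have t_le: "(\<integral>x. t k x \<partial>M) \<le> \<bar>c\<bar>" for k
  proof -
    have "0 \<le> (\<integral>x. indicator D x * (c - min (g x) (real k)) \<partial>M)"
    proof (rule maximal_ergodic)
      show "integrable M (\<lambda>x. indicator D x * (c - min (g x) (real k)))"
      proof (rule integrable_const_bound[where B = "\<bar>c\<bar> + real k"])
        have "\<bar>c - min (g x) (real k)\<bar> \<le> \<bar>c\<bar> + real k" for x using g[of x] by linarith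
        then show "AE x in M. norm (indicator D x * (c - min (g x) (real k))) \<le> \<bar>c\<bar> + real k"
          by (simp add: indicator_def)
      qed measurable
      show "T x \<in> D \<longleftrightarrow> x \<in> D" if "x \<in> space M" for x
        using measurable_space[OF T_measurable that] that by (simp add: D_def limsup_time_avg_step)
      fix x assume "x \<in> D"
      then have "\<forall>\<^sub>F n in sequentially. ereal (time_avg T g x n) < ereal c"
        unfolding D_def using Limsup_lessD by blast
      then have "\<forall>\<^sub>F n in sequentially. 0 < n \<and> time_avg T g x n < c"
        using eventually_gt_at_top[of 0] by eventually_elim simp
      then obtain n where n: "0 < n" "time_avg T g x n < c" by (auto simp: eventually_sequentially)
      have "(\<Sum>i<n. min (g ((T ^^ i) x)) (real k)) \<le> (\<Sum>i<n. g ((T ^^ i) x))"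
        by (intro sum_mono) simp
      also have "\<dots> < c * real n" using n by (simp add: time_avg_def field_simps)
      finally show "\<exists>n. 0 < (\<Sum>i<n. c - min (g ((T ^^ i) x)) (real k))"
        by (intro exI[of _ n]) (simp add: sum_subtractf mult.commute)
    qed
    also have "\<dots> = (\<integral>x. c * indicator D x - t k x \<partial>M)"
      by (intro Bochner_Integration.integral_cong) (auto simp: t_def indicator_def)
    also have "\<dots> = c * prob D - (\<integral>x. t k x \<partial>M)"
      using t_int[of k] D_int by (subst Bochner_Integration.integral_diff) auto
    finally have "(\<integral>x. t k x \<partial>M) \<le> c * prob D" by simp
    also have "\<dots> \<le> \<bar>c\<bar> * 1" by (intro mult_mono) auto
    finally show ?thesis by simp
  qed
  have t_mono: "t k x \<le> t j x" if "k \<le> j" for k j x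
    using that by (auto simp: t_def indicator_def)
  have "incseq (\<lambda>k. \<integral>x. t k x \<partial>M)"
    unfolding incseq_def using t_int t_mono by (auto intro!: integral_mono)
  then obtain l where l: "(\<lambda>k. \<integral>x. t k x \<partial>M) \<longlonglongrightarrow> l"
    using incseq_convergent[of "\<lambda>k. \<integral>x. t k x \<partial>M" "\<bar>c\<bar>"] t_le by blast
  show ?thesis
  proof (rule integrable_monotone_convergence[OF t_int _ _ l])
    show "AE x in M. mono (\<lambda>k. t k x)" by (simp add: mono_def t_mono)
    show "AE x in M. (\<lambda>k. t k x) \<longlonglongrightarrow> indicator D x * g x"
    proof (rule AE_I2)
      fix x
      obtain n where n: "g x \<le> real n" using real_arch_simple by blast
      have "\<forall>\<^sub>F k in sequentially. t k x = indicator D x * g x"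
        using eventually_ge_at_top[of n] by eventually_elim (use n in \<open>auto simp: t_def\<close>)
      then show "(\<lambda>k. t k x) \<longlonglongrightarrow> indicator D x * g x" by (rule tendsto_eventually)
    qed
  qed measurable
qed

text \<open>Birkhoff's argument on the invariant sets \<open>W a b c\<close> where the averages of \<open>g\<close> stay below \<open>c\<close> in the
  limit while those of \<open>h\<close> oscillate across \<open>[a, b]\<close>. There \<open>h\<close> is integrable, and the maximal ergodic
  theorem for \<open>h - b\<close> and for \<open>a - h\<close> adds up to \<open>0 \<le> (a - b) * prob (W a b c)\<close>, so the set is null.\<close>

theorem dominated_ergodic_theorem:
  fixes g h :: "'a \<Rightarrow> real"
  assumes [measurable]: "g \<in> borel_measurable M" "h \<in> borel_measurable M"
    and h: "\<And>x. 0 \<le> h x" and hg: "\<And>x. h x \<le> g x"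
    and fin: "AE x in M. limsup (\<lambda>n. ereal (time_avg T g x n)) < \<infinity>"
  shows "AE x in M. convergent (time_avg T h x)"
proof -
  define hi lo gh where "hi x = limsup (\<lambda>n. ereal (time_avg T h x n))"
    and "lo x = liminf (\<lambda>n. ereal (time_avg T h x n))"
    and "gh x = limsup (\<lambda>n. ereal (time_avg T g x n))" for x
  have [measurable]: "hi \<in> borel_measurable M" "lo \<in> borel_measurable M" "gh \<in> borel_measurable M"
    unfolding hi_def[abs_def] lo_def[abs_def] gh_def[abs_def] by measurable
  define W where "W a b c = {x\<in>space M. gh x < ereal c \<and> lo x < ereal a \<and> ereal b < hi x}" for a b c
  have [measurable]: "W a b c \<in> sets M" for a b c unfolding W_def by measurable
  have W_int1: "integrable M (indicat_real (W a b c))" for a b c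
    by (rule integrable_const_bound[where B = 1]) auto
  have null: "AE x in M. x \<notin> W a b c" if "a < b" for a b c
  proof -
    have W_int: "integrable M (\<lambda>x. indicator (W a b c) x * h x)"
    proof (rule Bochner_Integration.integrable_bound[OF integrable_where_limsup_bounded[of g c]])
      show "0 \<le> g x" for x using h[of x] hg[of x] by simp
      show "AE x in M. norm (indicator (W a b c) x * h x)
        \<le> norm (indicator {x \<in> space M. limsup (\<lambda>n. ereal (time_avg T g x n)) < ereal c} x * g x)"
        using h hg by (intro AE_I2) (auto simp: indicator_def W_def gh_def intro: order_trans[OF _ abs_ge_self])
    qed measurable
    \<comment> \<open>Strict bounds on the upper and lower limits, rather than on infinitely many averages, make \<open>W\<close> exactly invariant.\<close>
    have W_inv: "T x \<in> W a b c \<longleftrightarrow> x \<in> W a b c" if "x \<in> space M" for x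
      using measurable_space[OF T_measurable that] that
      by (simp add: W_def hi_def lo_def gh_def limsup_time_avg_step liminf_time_avg_step)
    have d1: "indicator (W a b c) x * (h x - r) = indicator (W a b c) x * h x - r * indicator (W a b c) x"
      and d2: "indicator (W a b c) x * (r - h x) = r * indicator (W a b c) x - indicator (W a b c) x * h x" for x r
      by (auto simp: indicator_def)
    have "0 \<le> (\<integral>x. indicator (W a b c) x * (h x - b) \<partial>M)"
    proof (rule maximal_ergodic[OF _ W_inv])
      show "integrable M (\<lambda>x. indicator (W a b c) x * (h x - b))"
        unfolding d1 using W_int W_int1[of a b c] by auto
      fix x assume "x \<in> W a b c"
      then have "\<not> hi x \<le> ereal b" by (auto simp: W_def not_le)
      moreover have "hi x \<le> ereal b" if "\<forall>n>0. time_avg T h x n \<le> b"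
        unfolding hi_def
        by (intro Limsup_bounded eventually_mono[OF eventually_gt_at_top[of 0]]) (simp add: that)
      ultimately obtain n where n: "n > 0" "b < time_avg T h x n" using not_le by blast
      then show "\<exists>n. 0 < (\<Sum>i<n. h ((T ^^ i) x) - b)"
        by (intro exI[of _ n]) (simp add: time_avg_def sum_subtractf field_simps)
    qed
    moreover have "0 \<le> (\<integral>x. indicator (W a b c) x * (a - h x) \<partial>M)"
    proof (rule maximal_ergodic[OF _ W_inv])
      show "integrable M (\<lambda>x. indicator (W a b c) x * (a - h x))"
        unfolding d2 using W_int W_int1[of a b c] by auto
      fix x assume "x \<in> W a b c"
      then have "lo x < ereal a" by (simp add: W_def)
      then obtain n where n: "n > 0" "ereal (time_avg T h x n) < ereal a"
        unfolding lo_def using liminf_upper_bound by blast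
      then show "\<exists>n. 0 < (\<Sum>i<n. a - h ((T ^^ i) x))"
        by (intro exI[of _ n]) (simp add: time_avg_def sum_subtractf field_simps)
    qed
    ultimately have "0 \<le> (a - b) * prob (W a b c)"
      unfolding d1 d2 using W_int W_int1[of a b c] by (simp add: algebra_simps)
    then have "prob (W a b c) = 0"
      using that measure_nonneg[of M "W a b c"] by (smt (verit) mult_neg_pos)
    then have "emeasure M (W a b c) = 0" by (simp add: emeasure_eq_measure)
    then show ?thesis by (intro AE_not_in) (auto simp: null_sets_def)
  qed
  have "AE x in M. \<forall>k::nat. \<forall>a::rat. \<forall>b::rat. a < b \<longrightarrow> x \<notin> W (of_rat a) (of_rat b) (real k)"
    by (simp add: AE_all_countable) (use null in \<open>auto simp: of_rat_less\<close>)
  with fin AE_space show ?thesis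
  proof eventually_elim
    case (elim x)
    have h_avg: "0 \<le> time_avg T h x n" and hg_avg: "time_avg T h x n \<le> time_avg T g x n" for n
      using h hg by (auto simp: time_avg_def intro!: divide_right_mono divide_nonneg_nonneg sum_nonneg sum_mono)
    obtain r where r: "gh x < ereal r" using elim(1) ereal_dense2[of "gh x" \<infinity>] by (auto simp: gh_def)
    obtain k :: nat where "r \<le> real k" using real_arch_simple by blast
    with r have k: "gh x < ereal (real k)" by (metis ereal_less_eq(3) less_le_trans)
    have lo_hi: "lo x \<le> hi x" unfolding lo_def hi_def by (simp add: Liminf_le_Limsup)
    have "0 \<le> lo x" unfolding lo_def by (intro Liminf_bounded) (simp add: h_avg)
    have "hi x \<le> gh x" unfolding hi_def gh_def by (intro Limsup_mono) (simp add: hg_avg)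
    have "\<not> lo x < hi x"
    proof
      assume "lo x < hi x"
      then obtain a' b' where "lo x < ereal a'" "ereal a' < ereal b'" "ereal b' < hi x"
        using ereal_dense2 by metis
      moreover from this(2) obtain a where "a' < of_rat a" "of_rat a < b'" using of_rat_dense by auto
      moreover from this(2) obtain b where "of_rat a < real_of_rat b" "of_rat b < b'" using of_rat_dense by metis
      ultimately have "lo x < ereal (of_rat a)" "ereal (of_rat b) < hi x" "a < b"
        using less_trans[of "lo x" "ereal a'" "ereal (of_rat a)"] less_trans[of "ereal (of_rat b)" "ereal b'" "hi x"]
        by (simp_all add: of_rat_less)
      then show False using elim k by (auto simp: W_def)
    qed
    with lo_hi have "lo x = hi x" by simp
    obtain L where L: "hi x = ereal L"
      using \<open>0 \<le> lo x\<close> \<open>lo x = hi x\<close> \<open>hi x \<le> gh x\<close> k by (cases "hi x") auto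
    have "time_avg T h x \<longlonglongrightarrow> L"
      by (rule limsup_le_liminf_real) (use L \<open>lo x = hi x\<close> in \<open>auto simp: lo_def hi_def\<close>)
    then show "convergent (time_avg T h x)" by (auto simp: convergent_def)
  qed
qed

end

section \<open>Asymptotically mean stationary measures\<close>

lemma space_seq_space [simp]: "space seq_space = UNIV"
  by (simp add: seq_space_def space_PiM)

lemma shift_measurable [measurable]: "shift \<in> measurable seq_space seq_space"
  unfolding shift_def seq_space_def by (rule measurable_PiM_single') (auto simp: space_PiM)

lemma shift_funpow: "(shift ^^ n) x = (\<lambda>i. x (i + int n))"
  by (induction n) (auto simp: shift_def fun_eq_iff algebra_simps)

lemma shift_funpow_measurable [measurable]: "(shift ^^ n) \<in> measurable seq_space seq_space"
  by (induction n) (simp_all add: measurable_comp[OF _ shift_measurable])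

lemma coordinate_measurable [measurable]: "(\<lambda>x. x i) \<in> measurable seq_space (count_space UNIV)"
  unfolding seq_space_def by (rule measurable_component_singleton) simp

lemma coordinate_fun_measurable [measurable]:
  "(\<lambda>x. g (x i)) \<in> measurable seq_space (count_space UNIV)"
  by (rule measurable_compose[OF coordinate_measurable]) simp

lemma coordinate_fun_borel_measurable [measurable]:
  "(\<lambda>x. g (x i)) \<in> borel_measurable seq_space"
  by (rule measurable_compose[OF coordinate_measurable]) simp

locale asymptotically_mean_stationary =
  fixes M :: "(int \<Rightarrow> 'a) measure"
  assumes AMS: "AMS M"
begin

sublocale prob_space M using AMS by (simp add: AMS_def)

lemma sets_M [measurable_cong, simp]: "sets M = sets seq_space"
  using AMS by (simp add: AMS_def)

lemma space_M [simp]: "space M = UNIV"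
  using sets_eq_imp_space_eq[OF sets_M] by simp

lemma shift_avg_tendsto: "A \<in> sets seq_space \<Longrightarrow> shift_avg M A \<longlonglongrightarrow> lim (shift_avg M A)"
  using AMS by (simp add: AMS_def convergent_LIMSEQ_iff)

lemma funpow_vimage_sets: "A \<in> sets seq_space \<Longrightarrow> (shift ^^ n) -` A \<in> sets M"
  using measurable_sets[OF shift_funpow_measurable[of n], of A] by simp

text \<open>The averages \<open>\<lambda>A. shift_avg M A n\<close> are finite measures that converge on every measurable set, so
  Nikodym's theorem applies to their limit.\<close>

lemma countably_additive_limit:
  "countably_additive (sets seq_space) (\<lambda>A. ennreal (lim (shift_avg M A)))"
proof -
  let ?q = "\<lambda>A. lim (shift_avg M A)"
  have nonneg: "0 \<le> shift_avg M A n" for A n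
    by (simp add: shift_avg_def sum_nonneg)
  have q_nonneg: "0 \<le> ?q A" if "A \<in> sets seq_space" for A
    using LIMSEQ_le_const[OF shift_avg_tendsto[OF that]] nonneg by blast
  have add: "shift_avg M (A \<union> B) n = shift_avg M A n + shift_avg M B n"
    if "A \<in> sets seq_space" "B \<in> sets seq_space" "A \<inter> B = {}" for A B n
  proof -
    have "measure M ((shift ^^ i) -` (A \<union> B)) = measure M ((shift ^^ i) -` A) + measure M ((shift ^^ i) -` B)" for i
      unfolding vimage_Un using that
      by (intro finite_measure_Union funpow_vimage_sets) (auto simp flip: vimage_Int)
    then show ?thesis by (simp add: shift_avg_def sum.distrib add_divide_distrib)
  qed
  show ?thesis
  proof (rule sets.empty_continuous_imp_countably_additive)
    have "shift_avg M {} = (\<lambda>n. 0)" by (simp add: shift_avg_def fun_eq_iff)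
    then show "positive (sets seq_space) (\<lambda>A. ennreal (?q A))" by (simp add: positive_def)
    show "additive (sets seq_space) (\<lambda>A. ennreal (?q A))"
      unfolding additive_def
    proof (intro ballI impI)
      fix A B assume AB: "A \<in> sets (seq_space :: (int \<Rightarrow> 'a) measure)" "B \<in> sets seq_space" "A \<inter> B = {}"
      have "(\<lambda>n. shift_avg M A n + shift_avg M B n) \<longlonglongrightarrow> ?q A + ?q B"
        by (intro tendsto_add shift_avg_tendsto AB)
      then have "shift_avg M (A \<union> B) \<longlonglongrightarrow> ?q A + ?q B" unfolding add[OF AB, symmetric] .
      then have "?q (A \<union> B) = ?q A + ?q B" by (rule limI)
      then show "ennreal (?q (A \<union> B)) = ennreal (?q A) + ennreal (?q B)"
        using q_nonneg AB by simp
    qed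
    fix A :: "nat \<Rightarrow> (int \<Rightarrow> 'a) set"
    assume A: "range A \<subseteq> sets seq_space" "decseq A" "(\<Inter>i. A i) = {}"
    have "(\<lambda>i. ?q (A i)) \<longlonglongrightarrow> 0"
    proof (rule sets.additive_limit_continuous_at_empty[OF _ _ _ _ A])
      fix k and B :: "nat \<Rightarrow> (int \<Rightarrow> 'a) set"
      assume B: "range B \<subseteq> sets seq_space" "decseq B" "(\<Inter>i. B i) = {}"
      have "(\<lambda>j. measure M ((shift ^^ i) -` B j)) \<longlonglongrightarrow> measure M (\<Inter>j. (shift ^^ i) -` B j)" for i
      proof (rule finite_Lim_measure_decseq)
        show "range (\<lambda>j. (shift ^^ i) -` B j) \<subseteq> sets M"
          using B(1) funpow_vimage_sets by blast
        show "decseq (\<lambda>j. (shift ^^ i) -` B j)"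
          using B(2) unfolding decseq_def by blast
      qed
      then have "(\<lambda>j. measure M ((shift ^^ i) -` B j)) \<longlonglongrightarrow> 0" for i
        using B(3) by (simp flip: vimage_INT)
      then have "(\<lambda>j. \<Sum>i<k. measure M ((shift ^^ i) -` B j)) \<longlonglongrightarrow> 0"
        by (intro tendsto_null_sum) auto
      then show "(\<lambda>j. shift_avg M (B j) k) \<longlonglongrightarrow> 0"
        unfolding shift_avg_def by (rule tendsto_divide_zero)
    qed (use nonneg add shift_avg_tendsto in auto)
    then show "(\<lambda>i. ennreal (?q (A i))) \<longlonglongrightarrow> 0" using tendsto_ennrealI by fastforce
  qed auto
qed

lemma sets_stationary_mean [measurable_cong, simp]: "sets (stationary_mean M) = sets seq_space"
  unfolding stationary_mean_def using sets.sigma_sets_eq[of "seq_space :: (int \<Rightarrow> 'a) measure"] sets.space_closed[of "seq_space :: (int \<Rightarrow> 'a) measure"]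
  by simp

lemma space_stationary_mean [simp]: "space (stationary_mean M) = UNIV"
  using sets_eq_imp_space_eq[OF sets_stationary_mean] by simp

lemma measure_stationary_mean:
  assumes A: "A \<in> sets seq_space"
  shows "measure (stationary_mean M) A = lim (shift_avg M A)"
proof -
  have "0 \<le> shift_avg M A n" for n by (simp add: shift_avg_def sum_nonneg)
  then have nonneg: "0 \<le> lim (shift_avg M A)"
    using LIMSEQ_le_const[OF shift_avg_tendsto[OF A]] by blast
  have "shift_avg M {} = (\<lambda>n. 0)" by (simp add: shift_avg_def fun_eq_iff)
  then have "positive (sets seq_space) (\<lambda>A. ennreal (lim (shift_avg M A)))" by (simp add: positive_def)
  then have "emeasure (stationary_mean M) A = ennreal (lim (shift_avg M A))"
    unfolding stationary_mean_def
    using A countably_additive_limit sets.sigma_algebra_axioms[of "seq_space :: (int \<Rightarrow> 'a) measure"]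
    by (intro emeasure_measure_of_sigma) simp_all
  then show ?thesis using nonneg by (simp add: measure_def)
qed

text \<open>All terms of the averages coincide on an invariant set. Through this lemma almost sure statements and
  integrals of invariant functions pass between \<open>M\<close> and its stationary mean.\<close>

lemma measure_stationary_mean_invariant:
  assumes A: "A \<in> sets seq_space" and inv: "shift -` A = A"
  shows "measure (stationary_mean M) A = measure M A"
proof -
  have "(shift ^^ i) -` A = A" for i
    by (induction i) (simp_all add: inv funpow_Suc_right vimage_comp[symmetric] del: funpow.simps(2) o_apply)
  then have shift_avg: "shift_avg M A n = measure M A" if "n > 0" for n
    using that by (simp add: shift_avg_def)
  have "\<forall>\<^sub>F n in sequentially. shift_avg M A n = measure M A"
    using eventually_gt_at_top[of 0] by eventually_elim (rule shift_avg)
  then have "shift_avg M A \<longlonglongrightarrow> measure M A" by (rule tendsto_eventually)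
  then show ?thesis by (simp add: measure_stationary_mean[OF A] limI)
qed

lemma prob_space_stationary_mean: "prob_space (stationary_mean M)"
proof -
  have "measure (stationary_mean M) UNIV = 1"
    using measure_stationary_mean_invariant[of UNIV] sets.top[of "seq_space :: (int \<Rightarrow> 'a) measure"] prob_space
    by simp
  then show ?thesis by (intro prob_spaceI) (cases "emeasure (stationary_mean M) UNIV" rule: ennreal_cases; simp add: measure_def)
qed

text \<open>The averages of \<open>shift -` A\<close> and of \<open>A\<close> differ by a telescoping sum divided by \<open>n\<close>.\<close>

sublocale mean: measure_preserving_system "stationary_mean M" shift
proof -
  interpret m: prob_space "stationary_mean M" by (rule prob_space_stationary_mean)
  show "measure_preserving_system (stationary_mean M) shift"
  proof
    show [measurable]: "shift \<in> measurable (stationary_mean M) (stationary_mean M)" by measurable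
    show "distr (stationary_mean M) (stationary_mean M) shift = stationary_mean M"
    proof (rule measure_eqI)
      fix A assume "A \<in> sets (distr (stationary_mean M) (stationary_mean M) shift)"
      then have A: "A \<in> sets seq_space" by simp
      then have A': "shift -` A \<in> sets seq_space"
        using measurable_sets[OF shift_measurable A] by simp
      have diff: "shift_avg M (shift -` A) n - shift_avg M A n
          = (measure M ((shift ^^ n) -` A) - measure M A) / real n" for n
        using sum_lessThan_telescope[of "\<lambda>i. measure M ((shift ^^ i) -` A)" n]
        by (simp add: shift_avg_def diff_divide_distrib[symmetric] sum_subtractf[symmetric] vimage_def)
      have "(\<lambda>n. shift_avg M (shift -` A) n - shift_avg M A n) \<longlonglongrightarrow> 0"
      proof (rule Lim_null_comparison)
        show "(\<lambda>n. 1 / real n) \<longlonglongrightarrow> 0" by real_asymp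
        show "\<forall>\<^sub>F n in sequentially. norm (shift_avg M (shift -` A) n - shift_avg M A n) \<le> 1 / real n"
        proof (intro always_eventually allI)
          fix n
          have "\<bar>prob ((shift ^^ n) -` A) - prob A\<bar> \<le> 1"
            using prob_le_1[of A] prob_le_1[of "(shift ^^ n) -` A"]
              measure_nonneg[of M A] measure_nonneg[of M "(shift ^^ n) -` A"] by linarith
          then show "norm (shift_avg M (shift -` A) n - shift_avg M A n) \<le> 1 / real n"
            unfolding diff by (simp add: divide_right_mono)
        qed
      qed
      then have "lim (shift_avg M (shift -` A)) = lim (shift_avg M A)"
        using tendsto_diff[OF shift_avg_tendsto[OF A'] shift_avg_tendsto[OF A]] LIMSEQ_unique by fastforce
      then show "emeasure (distr (stationary_mean M) (stationary_mean M) shift) A = emeasure (stationary_mean M) A"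
        using A A' by (simp add: emeasure_distr m.emeasure_eq_measure measure_stationary_mean)
    qed simp
  qed
qed

lemma AE_stationary_mean_iff:
  assumes [measurable]: "Measurable.pred seq_space P" and inv: "\<And>x. P (shift x) \<longleftrightarrow> P x"
  shows "(AE x in stationary_mean M. P x) \<longleftrightarrow> (AE x in M. P x)"
proof -
  have P: "{x. P x} \<in> sets seq_space"
    using assms(1) unfolding pred_def by simp
  have "measure (stationary_mean M) {x. P x} = measure M {x. P x}"
    by (rule measure_stationary_mean_invariant[OF P]) (simp add: inv)
  then show ?thesis
    using AE_in_set_eq_1[of "{x. P x}"] mean.AE_in_set_eq_1[of "{x. P x}"] P by simp
qed

lemma integral_stationary_mean_invariant:
  fixes \<phi> :: "(int \<Rightarrow> 'a) \<Rightarrow> real"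
  assumes [measurable]: "\<phi> \<in> borel_measurable seq_space" and inv: "\<And>x. \<phi> (shift x) = \<phi> x"
  shows "(\<integral>x. \<phi> x \<partial>stationary_mean M) = (\<integral>x. \<phi> x \<partial>M)"
proof -
  have "distr (stationary_mean M) borel \<phi> = distr M borel \<phi>"
  proof (rule measure_eqI)
    fix B assume "B \<in> sets (distr (stationary_mean M) borel \<phi>)"
    then have [measurable]: "B \<in> sets borel" by simp
    have "\<phi> -` B \<in> sets seq_space" using measurable_sets[OF assms(1), of B] by simp
    moreover have "shift -` (\<phi> -` B) = \<phi> -` B" by (auto simp: inv)
    ultimately have "measure (stationary_mean M) (\<phi> -` B) = measure M (\<phi> -` B)"
      by (rule measure_stationary_mean_invariant)
    then show "emeasure (distr (stationary_mean M) borel \<phi>) B = emeasure (distr M borel \<phi>) B"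
      by (simp add: emeasure_distr emeasure_eq_measure mean.emeasure_eq_measure)
  qed simp
  then have "(\<integral>y. y \<partial>distr (stationary_mean M) borel \<phi>) = (\<integral>y. y \<partial>distr M borel \<phi>)" by simp
  then show ?thesis by (simp add: integral_distr)
qed

text \<open>The sets \<open>E j\<close>, on which \<open>j\<close> is the first index with property \<open>Q\<close>, are disjoint for distinct \<open>j\<close> and
  have equal probability by stationarity, hence probability \<open>0\<close>. So almost surely there is no first
  index with property \<open>Q\<close>.\<close>

lemma recurrence_backwards:
  "AE x in stationary_mean M. (\<exists>i. Q (x i)) \<longrightarrow> (\<forall>n. \<exists>i\<le>n. Q (x i))"
proof -
  define E where "E j = {x. Q (x j) \<and> (\<forall>i<j. \<not> Q (x i))}" for j :: int
  have E_sets: "E j \<in> sets seq_space" for j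
  proof -
    have "{x \<in> space seq_space. Q (x j) \<and> (\<forall>i<j. \<not> Q (x i))} \<in> sets seq_space" by measurable
    then show ?thesis by (simp add: E_def)
  qed
  have "shift -` E j = E (j + 1)" for j
  proof (intro set_eqI iffI)
    fix x assume "x \<in> shift -` E j"
    then have "Q (x (j + 1))" "\<And>i. i < j \<Longrightarrow> \<not> Q (x (i + 1))" by (auto simp: E_def shift_def)
    then have "\<not> Q (x i)" if "i < j + 1" for i using that by (metis add_diff_inverse diff_add_cancel diff_less_eq)
    then show "x \<in> E (j + 1)" using \<open>Q (x (j + 1))\<close> by (simp add: E_def)
  qed (auto simp: E_def shift_def)
  then have E_Suc: "mean.prob (E (j + 1)) = mean.prob (E j)" for j
    using mean.prob_vimage[of "E j"] E_sets by simp
  have E_n: "mean.prob (E (j + int n)) = mean.prob (E j)" for j n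
  proof (induction n)
    case (Suc n)
    then show ?case using E_Suc[of "j + int n"] by (simp add: algebra_simps)
  qed simp
  have E_0: "mean.prob (E j) = 0" for j
  proof (rule ccontr)
    assume "mean.prob (E j) \<noteq> 0"
    then have pos: "0 < mean.prob (E j)" by (simp add: zero_less_measure_iff)
    then obtain N :: nat where N: "1 < real N * mean.prob (E j)" using reals_Archimedean3 by blast
    have "real N * mean.prob (E j) = (\<Sum>n<N. mean.prob (E (j + int n)))" by (simp add: E_n)
    also have "\<dots> = mean.prob (\<Union>n<N. E (j + int n))"
    proof (rule mean.finite_measure_finite_Union[symmetric])
      have "E (j + int m) \<inter> E (j + int n) = {}" if "m \<noteq> n" for m n
        using that by (cases m n rule: linorder_cases) (auto simp: E_def)
      then show "disjoint_family_on (\<lambda>n. E (j + int n)) {..<N}"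
        by (simp add: disjoint_family_on_def)
    qed (use E_sets in auto)
    finally show False using N mean.prob_le_1 by (metis not_le)
  qed
  have "AE x in stationary_mean M. \<forall>j. x \<notin> E j"
  proof (subst AE_all_countable, intro allI AE_not_in)
    show "E j \<in> null_sets (stationary_mean M)" for j
      using E_0[of j] E_sets[of j] by (simp add: null_sets_def mean.emeasure_eq_measure)
  qed
  then show ?thesis
  proof eventually_elim
    fix x assume x: "\<forall>j. x \<notin> E j"
    show "(\<exists>i. Q (x i)) \<longrightarrow> (\<forall>n. \<exists>i\<le>n. Q (x i))"
    proof (intro impI allI)
      fix n assume "\<exists>i. Q (x i)"
      then obtain i where i: "Q (x i)" by blast
      show "\<exists>j\<le>n. Q (x j)"
      proof (rule ccontr)
        assume *: "\<not> (\<exists>j\<le>n. Q (x j))"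
        \<comment> \<open>Otherwise \<open>Q\<close> fails up to \<open>n\<close>, and the first index after \<open>n\<close> at which it holds is the first one overall.\<close>
        define d where "d = (LEAST d. Q (x (n + int d)))"
        have "n < i" using i * by (meson not_le)
        then have "Q (x (n + int (nat (i - n))))" using i by simp
        then have d: "Q (x (n + int d))" unfolding d_def by (rule LeastI)
        have "\<not> Q (x k)" if "k < n + int d" for k
        proof (cases "k \<le> n")
          case False
          then have k: "k = n + int (nat (k - n))" "nat (k - n) < d" using that by auto
          then show ?thesis using not_less_Least[of "nat (k - n)"] unfolding d_def by metis
        qed (use * in blast)
        then have "x \<in> E (n + int d)" using d by (simp add: E_def)
        then show False using x by blast
      qed
    qed
  qed
qed

end

section \<open>Concatenation and the shift\<close>

lemma infinite_int_ge_iff: "infinite {i::int. a \<le> i \<and> P i} \<longleftrightarrow> (\<forall>n. \<exists>i\<ge>n. P i)"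
proof
  assume inf: "infinite {i. a \<le> i \<and> P i}"
  show "\<forall>n. \<exists>i\<ge>n. P i"
  proof (rule ccontr)
    assume "\<not> (\<forall>n. \<exists>i\<ge>n. P i)"
    then obtain n where "\<forall>i\<ge>n. \<not> P i" by blast
    then have "{i. a \<le> i \<and> P i} \<subseteq> {a..n}" by (auto simp: not_le intro: less_imp_le) (meson linorder_le_cases)
    then show False using inf finite_subset by blast
  qed
next
  assume *: "\<forall>n. \<exists>i\<ge>n. P i"
  show "infinite {i. a \<le> i \<and> P i}"
  proof
    assume "finite {i. a \<le> i \<and> P i}"
    then obtain b where b: "\<And>i. a \<le> i \<Longrightarrow> P i \<Longrightarrow> i \<le> b"
      using bdd_above_finite[of "{i. a \<le> i \<and> P i}"] by (auto simp: bdd_above_def)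
    obtain i where "i \<ge> max a (b + 1)" "P i" using * by blast
    then show False using b[of i] by simp
  qed
qed

lemma infinite_int_le_iff: "infinite {i::int. i \<le> a \<and> P i} \<longleftrightarrow> (\<forall>n. \<exists>i\<le>n. P i)"
proof -
  have "{i. i \<le> a \<and> P i} = uminus ` {i. - a \<le> i \<and> P (- i)}"
  proof (intro set_eqI iffI)
    fix i assume "i \<in> {i. i \<le> a \<and> P i}"
    then show "i \<in> uminus ` {i. - a \<le> i \<and> P (- i)}" by (intro image_eqI[of _ _ "- i"]) auto
  qed auto
  then have "infinite {i. i \<le> a \<and> P i} \<longleftrightarrow> infinite {i. - a \<le> i \<and> P (- i)}"
    by (simp add: finite_image_iff inj_on_def)
  also have "\<dots> \<longleftrightarrow> (\<forall>n. \<exists>i\<ge>n. P (- i))" by (rule infinite_int_ge_iff)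
  also have "\<dots> \<longleftrightarrow> (\<forall>n. \<exists>i\<le>n. P i)"
    by (metis minus_minus neg_le_iff_le)
  finally show ?thesis .
qed

lemma expandable_iff:
  "x \<in> expandable f \<longleftrightarrow> (\<forall>n. \<exists>i\<ge>n. f (x i) \<noteq> []) \<and> (\<forall>n. \<exists>i\<le>n. f (x i) \<noteq> [])"
  unfolding expandable_def mem_Collect_eq infinite_int_ge_iff infinite_int_le_iff ..

lemma shift_expandable_iff: "shift x \<in> expandable f \<longleftrightarrow> x \<in> expandable f"
proof -
  have "(\<forall>n. \<exists>i\<ge>n. P (i + 1)) \<longleftrightarrow> (\<forall>n. \<exists>i\<ge>n. P i)" for P :: "int \<Rightarrow> bool"
    by (metis add_le_cancel_right diff_add_cancel)
  note ge = this[of "\<lambda>i. f (x i) \<noteq> []"]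
  have "(\<forall>n. \<exists>i\<le>n. P (i + 1)) \<longleftrightarrow> (\<forall>n. \<exists>i\<le>n. P i)" for P :: "int \<Rightarrow> bool"
    by (metis add_le_cancel_right diff_add_cancel)
  note le = this[of "\<lambda>i. f (x i) \<noteq> []"]
  show ?thesis
    unfolding expandable_iff shift_def ge le ..
qed

lemma block_start_1: "block_start f x 1 = 1"
  by (simp add: block_start_def)

lemma block_start_step: "block_start f x (i + 1) = block_start f x i + int (length (f (x i)))"
proof (cases "1 \<le> i")
  case True
  then have "{1..<i + 1} = insert i {1..<i}" by auto
  then show ?thesis using True by (simp add: block_start_def)
next
  case False
  then have "{i..<1} = insert i {i + 1..<1}" by auto
  then show ?thesis using False by (simp add: block_start_def)
qed

lemma block_start_mono: "i \<le> j \<Longrightarrow> block_start f x i \<le> block_start f x j"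
proof (induction j rule: int_ge_induct)
  case (step j)
  then show ?case by (simp add: block_start_step)
qed simp

lemma block_start_less: "i \<le> j \<Longrightarrow> f (x j) \<noteq> [] \<Longrightarrow> block_start f x i < block_start f x (j + 1)"
  using block_start_mono[of i j f x] length_greater_0_conv[of "f (x j)"]
  unfolding block_start_step by linarith

lemma block_unique:
  assumes "block_start f x i \<le> k" "k < block_start f x (i + 1)"
    and "block_start f x j \<le> k" "k < block_start f x (j + 1)"
  shows "i = j"
proof (rule ccontr)
  assume "i \<noteq> j"
  then have "i + 1 \<le> j \<or> j + 1 \<le> i" by linarith
  then show False using assms block_start_mono[of "i + 1" j f x] block_start_mono[of "j + 1" i f x] by auto
qed

text \<open>Each nonempty block raises the block start by at least \<open>1\<close>, so the block starts are unbounded in both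
  directions, and some step of this monotone sequence passes \<open>k\<close>.\<close>

lemma block_exists:
  assumes "x \<in> expandable f"
  obtains i where "block_start f x i \<le> k" "k < block_start f x (i + 1)"
proof -
  have up: "\<exists>i\<ge>1. 1 + int n \<le> block_start f x i" for n
  proof (induction n)
    case 0
    show ?case by (intro exI[of _ 1]) (simp add: block_start_1)
  next
    case (Suc n)
    then obtain i where i: "1 \<le> i" "1 + int n \<le> block_start f x i" by blast
    obtain j where j: "i \<le> j" "f (x j) \<noteq> []" using assms by (auto simp: expandable_iff)
    show ?case using i j block_start_less[of i j f x] by (intro exI[of _ "j + 1"]) simp
  qed
  have down: "\<exists>i\<le>1. block_start f x i \<le> 1 - int n" for n
  proof (induction n)
    case 0
    show ?case by (intro exI[of _ 1]) (simp add: block_start_1)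
  next
    case (Suc n)
    then obtain i where i: "i \<le> 1" "block_start f x i \<le> 1 - int n" by blast
    obtain j where j: "j \<le> i - 1" "f (x j) \<noteq> []" using assms unfolding expandable_iff by blast
    have "block_start f x j < block_start f x (j + 1)" using j by (intro block_start_less) auto
    moreover have "block_start f x (j + 1) \<le> block_start f x i" using j by (intro block_start_mono) simp
    ultimately show ?case using i j by (intro exI[of _ j]) simp
  qed
  have "1 - int (nat (1 - k)) \<le> k" by simp
  then obtain a where a: "a \<le> 1" "block_start f x a \<le> k"
    using down[of "nat (1 - k)"] order_trans by blast
  have "k < 1 + int (nat k)" by simp
  then obtain b where b: "1 \<le> b" "k < block_start f x b"
    using up[of "nat k"] less_le_trans by blast
  have "\<exists>i. block_start f x i \<le> k \<and> k < block_start f x (i + 1)"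
    if "a \<le> b" "k < block_start f x b" for b
    using that
  proof (induction b rule: int_ge_induct)
    case base
    then show ?case using a by simp
  next
    case (step b)
    then show ?case by (cases "k < block_start f x b") (auto simp: not_less)
  qed
  then show ?thesis using a b that by (meson order_trans)
qed

lemma expand_eq:
  assumes "x \<in> expandable f" "block_start f x i \<le> k" "k < block_start f x (i + 1)"
  shows "expand f x k = f (x i) ! nat (k - block_start f x i)"
proof -
  have "(THE i. block_start f x i \<le> k \<and> k < block_start f x (i + 1)) = i"
    using assms block_unique by (intro the_equality) blast+
  then show ?thesis using assms by (simp add: expand_def)
qed

text \<open>Both sides satisfy the same recursion in \<open>i\<close>, so it suffices to compare them at \<open>i = 1\<close>.\<close>

lemma block_start_shift:
  "block_start f (shift x) i = block_start f x (i + 1) - int (length (f (x 1)))"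
proof -
  define d where "d i = block_start f (shift x) i - block_start f x (i + 1)" for i
  have step: "d (i + 1) = d i" for i
    unfolding d_def using block_start_step[of f "shift x" i] block_start_step[of f x "i + 1"]
    by (simp add: shift_def)
  have "d i = d 1"
  proof (induction i rule: int_induct[where k = 1])
    case (step1 i)
    then show ?case using step[of i] by simp
  next
    case (step2 i)
    then show ?case using step[of "i - 1"] by simp
  qed simp
  then show ?thesis
    using block_start_step[of f x 1] by (simp add: d_def block_start_1)
qed

text \<open>Removing one symbol of the input moves the output by the length of one block. The identity also holds
  where \<open>expand\<close> takes its dummy value, which is a constant sequence.\<close>

lemma expand_shift: "expand f (shift x) = (shift ^^ length (f (x 1))) (expand f x)"
proof (cases "x \<in> expandable f")
  case True
  show ?thesis
  proof
    fix k
    obtain i where i: "block_start f (shift x) i \<le> k" "k < block_start f (shift x) (i + 1)"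
      using block_exists True shift_expandable_iff by metis
    have "expand f x (k + int (length (f (x 1)))) = f (x (i + 1)) ! nat (k + int (length (f (x 1))) - block_start f x (i + 1))"
      using i True by (intro expand_eq) (auto simp: block_start_shift)
    moreover have "expand f (shift x) k = f (shift x i) ! nat (k - block_start f (shift x) i)"
      using i True by (intro expand_eq) (auto simp: shift_expandable_iff)
    ultimately show "expand f (shift x) k = (shift ^^ length (f (x 1))) (expand f x) k"
      by (simp add: shift_funpow block_start_shift) (simp add: shift_def algebra_simps)
  qed
next
  case False
  then show ?thesis by (simp add: expand_def shift_expandable_iff shift_funpow)
qed

lemma S_Suc: "S f x (Suc n) = S f x n + length (f (x (int n + 1)))"
  by (simp add: S_def add.commute)

lemma expand_shift_funpow: "expand f ((shift ^^ n) x) = (shift ^^ S f x n) (expand f x)"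
proof (induction n)
  case 0
  show ?case by (simp add: S_def)
next
  case (Suc n)
  have "expand f ((shift ^^ Suc n) x) = (shift ^^ length (f (x (int n + 1)))) ((shift ^^ S f x n) (expand f x))"
    using Suc by (simp add: expand_shift) (simp add: shift_funpow add.commute)
  then show ?case by (simp add: S_Suc shift_funpow algebra_simps)
qed

text \<open>The first \<open>S f x n\<close> coordinates of the output consist of \<open>n\<close> complete blocks; \<open>G\<close> collects one block.\<close>

lemma sum_F_eq_sum_G: "(\<Sum>k<S f x n. F f A k x) = (\<Sum>i<n. G f A ((shift ^^ i) x))"
proof (induction n)
  case 0
  show ?case by (simp add: S_def)
next
  case (Suc n)
  have F_add: "F f A (S f x n + k) x = F f A k ((shift ^^ n) x)" for k
    by (simp add: F_def expand_shift_funpow add.commute[of "S f x n"] funpow_add)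
  have "(\<Sum>k<S f x (Suc n). F f A k x)
      = (\<Sum>k<S f x n. F f A k x) + (\<Sum>k<length (f (x (int n + 1))). F f A (S f x n + k) x)"
    unfolding S_Suc by (simp add: lessThan_atLeast0 sum.atLeastLessThan_shift_0[of _ "S f x n"]
        flip: sum.atLeastLessThan_concat[of 0 "S f x n" "S f x n + length (f (x (int n + 1)))"])
  then show ?case using Suc
    by (simp add: F_add G_def) (simp add: shift_funpow add.commute)
qed

lemma block_start_measurable [measurable]:
  "(\<lambda>x. real_of_int (block_start f x i)) \<in> borel_measurable seq_space"
  unfolding block_start_def by simp measurable

lemma expandable_measurable [measurable]: "Measurable.pred seq_space (\<lambda>x. x \<in> expandable f)"
  unfolding expandable_iff by measurable

text \<open>The value at \<open>k\<close> is described by a countable disjunction over the number \<open>i\<close> of the block that covers \<open>k\<close>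
  and its start \<open>c\<close>. The block starts are compared as reals so that they are measurable as Borel functions.\<close>

lemma expand_measurable [measurable]:
  fixes f :: "'x \<Rightarrow> 'y::countable list"
  shows "expand f \<in> measurable seq_space seq_space"
proof -
  have "(\<lambda>x. expand f x k) \<in> measurable seq_space (count_space UNIV)" for k
  proof (subst measurable_count_space_eq2_countable, intro conjI ballI)
    fix y :: 'y
    have eq: "expand f x k = y \<longleftrightarrow> x \<in> expandable f \<and>
        (\<exists>i c. real_of_int (block_start f x i) = real_of_int c \<and> c \<le> k
          \<and> real_of_int k < real_of_int (block_start f x (i + 1)) \<and> f (x i) ! nat (k - c) = y)
        \<or> x \<notin> expandable f \<and> undefined = y" (is "_ = ?R x") for x
    proof (cases "x \<in> expandable f")
      case True
      obtain i where "block_start f x i \<le> k" "k < block_start f x (i + 1)"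
        using block_exists[OF True] .
      note i = this
      have val: "expand f x k = f (x j) ! nat (k - block_start f x j)"
        if "block_start f x j \<le> k" "k < block_start f x (j + 1)" for j
        using expand_eq[OF True that] .
      show ?thesis
      proof
        assume "expand f x k = y"
        then show "?R x" using True i val[OF i] by (intro disjI1 conjI exI[of _ i] exI[of _ "block_start f x i"]) auto
      next
        assume "?R x"
        then obtain j c where "block_start f x j = c" "c \<le> k" "k < block_start f x (j + 1)" "f (x j) ! nat (k - c) = y"
          using True by auto
        then show "expand f x k = y" using val[of j] by simp
      qed
    qed (simp add: expand_def)
    have "Measurable.pred seq_space (\<lambda>x. real_of_int (block_start f x i) = real_of_int c)"
      "Measurable.pred seq_space (\<lambda>x. real_of_int k < real_of_int (block_start f x i))"
      for i c by measurable
    moreover have "Measurable.pred seq_space (\<lambda>x. f (x i) ! nat (k - c) = y)" for i c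
      by (rule coordinate_fun_measurable)
    ultimately have "Measurable.pred seq_space ?R"
      by (intro pred_intros_logic pred_intros_countable expandable_measurable) simp_all
    then show "(\<lambda>x. expand f x k) -` {y} \<inter> space seq_space \<in> sets seq_space"
      by (simp add: vimage_def eq pred_def)
  qed (auto simp: space_PiM)
  then show ?thesis
    unfolding seq_space_def[where 'a = 'y] by (intro measurable_PiM_single') (auto simp: space_PiM)
qed

section \<open>Averages along a subsequence of positive density\<close>

text \<open>For \<open>n = \<lfloor>N / l\<rfloor>\<close> the index \<open>s n\<close> is close to \<open>N\<close> in the sense that \<open>s n / N \<longrightarrow> 1\<close>. As the terms are
  bounded by \<open>1\<close>, the two partial sums differ by at most \<open>\<bar>N - s n\<bar> = o(N)\<close>.\<close>

lemma averages_along_linear_subsequence: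
  fixes a :: "nat \<Rightarrow> real" and s :: "nat \<Rightarrow> nat"
  assumes a: "\<And>k. 0 \<le> a k" "\<And>k. a k \<le> 1"
    and s: "(\<lambda>n. real (s n) / real n) \<longlonglongrightarrow> l" and l: "0 < l"
    and c: "(\<lambda>n. (\<Sum>k<s n. a k) / real (s n)) \<longlonglongrightarrow> c"
  shows "(\<lambda>N. (\<Sum>k<N. a k) / real N) \<longlonglongrightarrow> c"
proof -
  define A where "A N = (\<Sum>k<N. a k)" for N
  define n where "n N = nat \<lfloor>real N / l\<rfloor>" for N :: nat
  have n_lim: "(\<lambda>N. real (n N) / real N) \<longlonglongrightarrow> 1 / l" and n_top: "filterlim n at_top sequentially"
  proof -
    have "(\<lambda>N. real_of_int \<lfloor>real N / l\<rfloor> / real N) \<longlonglongrightarrow> 1 / l" using l by (real_asymp simp: inverse_eq_divide)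
    moreover have "real (n N) = real_of_int \<lfloor>real N / l\<rfloor>" for N
      using l by (simp add: n_def)
    ultimately show "(\<lambda>N. real (n N) / real N) \<longlonglongrightarrow> 1 / l" by simp
    show "filterlim n at_top sequentially"
      unfolding n_def using l by real_asymp
  qed
  have "(\<lambda>N. real (s (n N)) / real (n N) * (real (n N) / real N)) \<longlonglongrightarrow> l * (1 / l)"
    by (intro tendsto_mult n_lim filterlim_compose[OF s n_top])
  moreover have "\<forall>\<^sub>F N in sequentially. real (s (n N)) / real (n N) * (real (n N) / real N) = real (s (n N)) / real N"
    using n_top[unfolded filterlim_at_top, rule_format, of 1] by eventually_elim simp
  ultimately have ratio: "(\<lambda>N. real (s (n N)) / real N) \<longlonglongrightarrow> 1"
    using l Lim_transform_eventually[of _ "l * (1 / l)"] by force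
  have A_diff: "\<bar>A M - A N\<bar> \<le> \<bar>real M - real N\<bar>" for M N
  proof (induction M N rule: linorder_wlog)
    case (le M N)
    then have "A N - A M = (\<Sum>k\<in>{M..<N}. a k)"
      unfolding A_def lessThan_atLeast0 by (subst sum_diff_nat_ivl) auto
    moreover have "(\<Sum>k\<in>{M..<N}. a k) \<le> (\<Sum>k\<in>{M..<N}. 1)" using a by (intro sum_mono) auto
    moreover have "0 \<le> (\<Sum>k\<in>{M..<N}. a k)" using a by (intro sum_nonneg) auto
    ultimately show ?case using le by (simp add: of_nat_diff)
  qed (simp add: abs_minus_commute)
  have main: "(\<lambda>N. A (s (n N)) / real N) \<longlonglongrightarrow> c"
  proof -
    have "(\<lambda>N. A (s (n N)) / real (s (n N)) * (real (s (n N)) / real N)) \<longlonglongrightarrow> c * 1"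
      unfolding A_def by (intro tendsto_mult ratio filterlim_compose[OF c n_top])
    moreover have "A (s (n N)) / real (s (n N)) * (real (s (n N)) / real N) = A (s (n N)) / real N" for N
      by (cases "s (n N) = 0") (simp_all add: A_def)
    ultimately show ?thesis by (simp only: mult_1_right)
  qed
  have "(\<lambda>N. A N / real N - A (s (n N)) / real N) \<longlonglongrightarrow> 0"
  proof (rule Lim_null_comparison)
    show "(\<lambda>N. \<bar>1 - real (s (n N)) / real N\<bar>) \<longlonglongrightarrow> 0"
      using tendsto_rabs[OF tendsto_diff[OF tendsto_const ratio], of 1] by simp
    show "\<forall>\<^sub>F N in sequentially. norm (A N / real N - A (s (n N)) / real N) \<le> \<bar>1 - real (s (n N)) / real N\<bar>"
      using eventually_gt_at_top[of 0]
    proof eventually_elim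
      case (elim N)
      have "\<bar>A N / real N - A (s (n N)) / real N\<bar> = \<bar>A N - A (s (n N))\<bar> / real N"
        by (simp add: diff_divide_distrib[symmetric])
      also have "\<dots> \<le> \<bar>real N - real (s (n N))\<bar> / real N" by (intro divide_right_mono A_diff) simp
      also have "\<dots> = \<bar>1 - real (s (n N)) / real N\<bar>"
        using elim by (simp add: field_simps)
      finally show ?case by simp
    qed
  qed
  from tendsto_add[OF this main] show ?thesis by (simp add: A_def)
qed

section \<open>The averages over the input\<close>

lemma S_avg: "real (S f x n) / real n = time_avg shift (\<lambda>x. real (length (f (x 1)))) x n"
  by (simp add: S_def time_avg_def shift_funpow sum.atLeast1_atMost_eq add.commute)

lemma G_avg_eq: "G_avg f A x = time_avg shift (G f A) x"
  by (simp add: fun_eq_iff G_avg_def time_avg_def)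

lemma expansion_rate_tendsto_shift:
  "(\<lambda>n. real (S f (shift x) n) / real n) \<longlonglongrightarrow> L \<longleftrightarrow> (\<lambda>n. real (S f x n) / real n) \<longlonglongrightarrow> L"
  unfolding S_avg using time_avg_tendsto_step[of shift _ x L] by simp

lemma expansion_rate_shift: "expansion_rate f (shift x) = expansion_rate f x"
  by (simp add: expansion_rate_def lim_def expansion_rate_tendsto_shift)

lemma rate_pos_finite_shift: "rate_pos_finite f (shift x) \<longleftrightarrow> rate_pos_finite f x"
  by (simp add: rate_pos_finite_def convergent_def expansion_rate_tendsto_shift expansion_rate_shift)

lemma lim_G_avg_shift: "lim (G_avg f A (shift x)) = lim (G_avg f A x)"
  by (simp add: G_avg_eq lim_def time_avg_tendsto_step)

lemma convergent_G_avg_shift: "convergent (G_avg f A (shift x)) \<longleftrightarrow> convergent (G_avg f A x)"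
  by (simp add: G_avg_eq convergent_def time_avg_tendsto_step)

lemma S_measurable [measurable]: "(\<lambda>x. real (S f x n)) \<in> borel_measurable seq_space"
  unfolding S_def of_nat_sum by measurable

lemma expansion_rate_measurable [measurable]: "expansion_rate f \<in> borel_measurable seq_space"
  unfolding expansion_rate_def[abs_def] by measurable

lemma rate_pos_finite_measurable [measurable]: "Measurable.pred seq_space (rate_pos_finite f)"
  unfolding rate_pos_finite_def[abs_def] by measurable

context
  fixes f :: "'x \<Rightarrow> 'y::countable list" and A :: "(int \<Rightarrow> 'y) set"
  assumes A [measurable]: "A \<in> sets seq_space"
begin

lemma F_measurable: "F f A k \<in> borel_measurable seq_space"
  unfolding F_def by measurable

text \<open>The number of summands depends on \<open>x\<close>; extending the sum to all \<open>k\<close> by zeros removes this dependence.\<close>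

lemma G_measurable: "G f A \<in> borel_measurable seq_space"
proof -
  note [measurable] = F_measurable
  have "G f A x = (\<Sum>k. if real k < real (length (f (x 1))) then F f A k x else 0)" for x
    by (subst suminf_finite[of "{..<length (f (x 1))}"]) (auto simp: G_def)
  then have "G f A = (\<lambda>x. \<Sum>k. if real k < real (length (f (x 1))) then F f A k x else 0)"
    by blast
  also have "\<dots> \<in> borel_measurable seq_space" by measurable
  finally show ?thesis .
qed

lemma G_avg_measurable: "(\<lambda>x. G_avg f A x n) \<in> borel_measurable seq_space"
proof -
  note [measurable] = G_measurable
  show ?thesis unfolding G_avg_def by measurable
qed

lemma F_avg_measurable: "(\<lambda>x. F_avg f A x n) \<in> borel_measurable seq_space"
proof -
  note [measurable] = G_measurable
  show ?thesis unfolding F_avg_def sum_F_eq_sum_G by measurable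
qed

end

lemma F_bounds: "0 \<le> F f A k x" "F f A k x \<le> 1"
  by (simp_all add: F_def)

lemma G_bounds: "0 \<le> G f A x" "G f A x \<le> real (length (f (x 1)))"
proof -
  show "0 \<le> G f A x" by (simp add: G_def F_bounds sum_nonneg)
  have "G f A x \<le> (\<Sum>k<length (f (x 1)). 1)" unfolding G_def by (intro sum_mono F_bounds)
  then show "G f A x \<le> real (length (f (x 1)))" by simp
qed

lemma F_avg_bounds: "0 \<le> F_avg f A x n" "F_avg f A x n \<le> 1"
proof -
  show "0 \<le> F_avg f A x n" by (simp add: F_avg_def F_bounds sum_nonneg)
  have "(\<Sum>k<S f x n. F f A k x) \<le> (\<Sum>k<S f x n. 1)" by (intro sum_mono F_bounds)
  then show "F_avg f A x n \<le> 1" unfolding F_avg_def by (intro divide_le_eq_1[THEN iffD2]) auto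
qed

lemma rate_pos_finiteD:
  assumes "rate_pos_finite f x"
  shows "(\<lambda>n. real (S f x n) / real n) \<longlonglongrightarrow> expansion_rate f x" "0 < expansion_rate f x"
  using assms by (simp_all add: rate_pos_finite_def expansion_rate_def convergent_LIMSEQ_iff)

text \<open>\<open>F_avg\<close> is the quotient of \<open>G_avg\<close> and \<open>S f x n / n\<close>.\<close>

lemma F_avg_tendsto:
  assumes rate: "rate_pos_finite f x" and conv: "convergent (G_avg f A x)"
  shows "F_avg f A x \<longlonglongrightarrow> inverse (expansion_rate f x) * lim (G_avg f A x)"
proof -
  have "(\<lambda>n. G_avg f A x n / (real (S f x n) / real n)) \<longlonglongrightarrow> lim (G_avg f A x) / expansion_rate f x"
    using conv rate_pos_finiteD[OF rate] by (intro tendsto_divide) (auto simp: convergent_LIMSEQ_iff)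
  moreover have "\<forall>\<^sub>F n in sequentially. G_avg f A x n / (real (S f x n) / real n) = F_avg f A x n"
    using eventually_gt_at_top[of 0]
    by eventually_elim (simp add: F_avg_def G_avg_def sum_F_eq_sum_G)
  ultimately have "F_avg f A x \<longlonglongrightarrow> lim (G_avg f A x) / expansion_rate f x"
    by (rule Lim_transform_eventually)
  then show ?thesis by (simp add: field_simps)
qed

lemma unbounded_nonempty_blocks:
  assumes rate: "rate_pos_finite f x"
  shows "\<forall>n. \<exists>i\<ge>n. f (x i) \<noteq> []"
proof (rule ccontr)
  assume "\<not> (\<forall>n. \<exists>i\<ge>n. f (x i) \<noteq> [])"
  then obtain m where m: "\<And>i. m \<le> i \<Longrightarrow> f (x i) = []" by blast
  have S_const: "S f x (nat m + n) = S f x (nat m)" for n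
  proof (induction n)
    case (Suc n)
    have "m \<le> int (nat m + n) + 1" by simp
    then show ?case using Suc m by (simp add: S_Suc)
  qed simp
  have "(\<lambda>n. real (S f x (nat m)) / real n) \<longlonglongrightarrow> 0"
    by (rule tendsto_divide_0[OF tendsto_const filterlim_real_sequentially[THEN filterlim_at_top_imp_at_infinity]])
  moreover have "\<forall>\<^sub>F n in sequentially. real (S f x (nat m)) / real n = real (S f x n) / real n"
    using eventually_ge_at_top[of "nat m"]
    by eventually_elim (metis S_const le_add_diff_inverse)
  ultimately have "(\<lambda>n. real (S f x n) / real n) \<longlonglongrightarrow> 0" by (rule Lim_transform_eventually)
  then show False using rate_pos_finiteD[OF rate] LIMSEQ_unique by fastforce
qed

section \<open>The image measure\<close>

context asymptotically_mean_stationary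
begin

text \<open>A positive rate yields infinitely many nonempty blocks to the right, and recurrence for the
  stationary mean yields them to the left. Both properties are invariant, so they pass to \<open>M\<close>.\<close>

lemma AE_expandable:
  assumes "AE x in M. rate_pos_finite f x"
  shows "AE x in M. x \<in> expandable f"
proof -
  have "AE x in stationary_mean M. rate_pos_finite f x"
    using assms by (subst AE_stationary_mean_iff) (simp_all add: rate_pos_finite_shift)
  then have "AE x in stationary_mean M. x \<in> expandable f"
    using recurrence_backwards[of "\<lambda>a. f a \<noteq> []"]
  proof eventually_elim
    case (elim x)
    then show ?case using unbounded_nonempty_blocks[of f x] unfolding expandable_iff by blast
  qed
  then show ?thesis by (subst (asm) AE_stationary_mean_iff) (simp_all add: shift_expandable_iff)
qed

text \<open>The block length \<open>\<lambda>x. length (f (x 1))\<close> dominates \<open>G f A\<close>, and its averages converge to the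
  expansion rate, which is finite. The block length may fail to be integrable, so Birkhoff's theorem for
  integrable functions does not suffice.\<close>

lemma AE_convergent_G_avg:
  fixes f :: "'a \<Rightarrow> 'y::countable list"
  assumes rate: "AE x in stationary_mean M. rate_pos_finite f x" and A: "A \<in> sets seq_space"
  shows "AE x in stationary_mean M. convergent (G_avg f A x)"
  unfolding G_avg_eq
proof (rule mean.dominated_ergodic_theorem)
  let ?g = "\<lambda>x::int \<Rightarrow> 'a. real (length (f (x 1)))"
  show "?g \<in> borel_measurable (stationary_mean M)" by measurable
  show "G f A \<in> borel_measurable (stationary_mean M)" using G_measurable[OF A] by measurable
  show "0 \<le> G f A x" "G f A x \<le> ?g x" for x by (rule G_bounds)+
  show "AE x in stationary_mean M. limsup (\<lambda>n. ereal (time_avg shift ?g x n)) < \<infinity>"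
    using rate
  proof eventually_elim
    case (elim x)
    have "(\<lambda>n. ereal (time_avg shift ?g x n)) \<longlonglongrightarrow> ereal (expansion_rate f x)"
      using rate_pos_finiteD(1)[OF elim] unfolding S_avg by (rule tendsto_ereal)
    then have "limsup (\<lambda>n. ereal (time_avg shift ?g x n)) = ereal (expansion_rate f x)"
      by (intro lim_imp_Limsup) simp_all
    then show ?case by simp
  qed
qed

text \<open>The averages of the image measure are integrals of averages of \<open>F\<close> over all \<open>n\<close>. These converge almost surely
  because they converge along the block boundaries \<open>S f x n\<close>, which grow linearly; dominated convergence
  then gives the limit of the integrals.\<close>

lemma shift_avg_expand_tendsto:
  fixes f :: "'a \<Rightarrow> 'y::countable list"
  assumes rate: "AE x in M. rate_pos_finite f x" and conv: "AE x in M. convergent (G_avg f A x)"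
    and A: "A \<in> sets seq_space"
  shows "shift_avg (distr M seq_space (expand f)) A \<longlonglongrightarrow> (\<integral>x. lim (F_avg f A x) \<partial>M)"
proof -
  note [measurable] = F_measurable[OF A] F_avg_measurable[OF A]
  have F_int: "integrable M (F f A k)" for k
    by (rule integrable_const_bound[where B = 1]) (auto simp: F_bounds)
  have prob_F: "measure (distr M seq_space (expand f)) ((shift ^^ i) -` A) = (\<integral>x. F f A i x \<partial>M)" for i
  proof -
    have B: "(shift ^^ i) -` A \<in> sets seq_space"
      using measurable_sets[OF shift_funpow_measurable A] by simp
    have "measure (distr M seq_space (expand f)) ((shift ^^ i) -` A) = prob (expand f -` (shift ^^ i) -` A)"
      using B by (subst measure_distr) auto
    also have "\<dots> = (\<integral>x. indicator (expand f -` (shift ^^ i) -` A) x \<partial>M)" by simp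
    also have "\<dots> = (\<integral>x. F f A i x \<partial>M)"
      by (intro Bochner_Integration.integral_cong) (auto simp: F_def indicator_def)
    finally show ?thesis .
  qed
  have avg: "shift_avg (distr M seq_space (expand f)) A n = (\<integral>x. (\<Sum>k<n. F f A k x) / real n \<partial>M)" for n
    using F_int by (simp add: shift_avg_def prob_F)
  show ?thesis
    unfolding avg
  proof (rule integral_dominated_convergence[where w = "\<lambda>x. 1"])
    show "AE x in M. (\<lambda>n. (\<Sum>k<n. F f A k x) / real n) \<longlonglongrightarrow> lim (F_avg f A x)"
      using rate conv
    proof eventually_elim
      case (elim x)
      have "F_avg f A x \<longlonglongrightarrow> lim (F_avg f A x)"
        using F_avg_tendsto[OF elim] limI by metis
      then show ?case
        unfolding F_avg_def
        by (intro averages_along_linear_subsequence[OF F_bounds rate_pos_finiteD[OF elim(1)]])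
    qed
    show "AE x in M. norm ((\<Sum>k<n. F f A k x) / real n) \<le> 1" for n
    proof (rule AE_I2)
      fix x
      have "(\<Sum>k<n. F f A k x) \<le> (\<Sum>k<n. 1)" by (intro sum_mono F_bounds)
      then have "(\<Sum>k<n. F f A k x) / real n \<le> 1" by (intro divide_le_eq_1[THEN iffD2]) auto
      then show "norm ((\<Sum>k<n. F f A k x) / real n) \<le> 1"
        by (simp add: F_bounds sum_nonneg)
    qed
  qed simp_all
qed

end

theorem proposition2p3:
  fixes \<mu> :: "(int \<Rightarrow> 'x::countable) measure"
    and f :: "'x \<Rightarrow> 'y::countable list"
  defines "\<nu> \<equiv> distr \<mu> seq_space (expand f)"
  assumes ams: "AMS \<mu>"
    and rate: "AE x in \<mu>. rate_pos_finite f x"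
  shows "(AE x in \<mu>. x \<in> expandable f)
    \<and> expand f \<in> measurable \<mu> seq_space
    \<and> AMS \<nu>
    \<and> (AE x in stationary_mean \<mu>. rate_pos_finite f x)
    \<and> (\<forall>A\<in>sets seq_space.
        (AE x in \<mu>. convergent (F_avg f A x))
      \<and> (AE x in \<mu>. convergent (G_avg f A x))
      \<and> (AE x in stationary_mean \<mu>. convergent (G_avg f A x))
      \<and> integrable \<mu> (\<lambda>x. lim (F_avg f A x))
      \<and> integrable \<mu> (\<lambda>x. inverse (expansion_rate f x) * lim (G_avg f A x))
      \<and> integrable (stationary_mean \<mu>) (\<lambda>x. inverse (expansion_rate f x) * lim (G_avg f A x))
      \<and> measure (stationary_mean \<nu>) A = (\<integral>x. lim (F_avg f A x) \<partial>\<mu>)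
      \<and> measure (stationary_mean \<nu>) A
          = (\<integral>x. inverse (expansion_rate f x) * lim (G_avg f A x) \<partial>\<mu>)
      \<and> measure (stationary_mean \<nu>) A
          = (\<integral>x. inverse (expansion_rate f x) * lim (G_avg f A x) \<partial>stationary_mean \<mu>))"
proof -
  interpret asymptotically_mean_stationary \<mu> by unfold_locales (rule ams)
  have expand_meas [measurable]: "expand f \<in> measurable \<mu> seq_space" by measurable
  have rate_mean: "AE x in stationary_mean \<mu>. rate_pos_finite f x"
    using rate by (subst AE_stationary_mean_iff) (simp_all add: rate_pos_finite_shift)
  have conv_mean: "AE x in stationary_mean \<mu>. convergent (G_avg f A x)"
    and conv: "AE x in \<mu>. convergent (G_avg f A x)" if A: "A \<in> sets seq_space" for A
  proof -
    show *: "AE x in stationary_mean \<mu>. convergent (G_avg f A x)"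
      by (rule AE_convergent_G_avg[OF rate_mean A])
    have "Measurable.pred seq_space (\<lambda>x. convergent (G_avg f A x))"
      using convergent_measurable[OF G_avg_measurable[OF A, of f]] by simp
    from AE_stationary_mean_iff[OF this convergent_G_avg_shift] *
    show "AE x in \<mu>. convergent (G_avg f A x)" by blast
  qed
  have \<nu>_tendsto: "shift_avg \<nu> A \<longlonglongrightarrow> (\<integral>x. lim (F_avg f A x) \<partial>\<mu>)" if "A \<in> sets seq_space" for A
    unfolding \<nu>_def by (rule shift_avg_expand_tendsto[OF rate conv[OF that] that])
  have ams_\<nu>: "AMS \<nu>"
    unfolding AMS_def
  proof (intro conjI ballI)
    show "prob_space \<nu>" unfolding \<nu>_def by (rule prob_space_distr[OF expand_meas])
    show "sets \<nu> = sets seq_space" by (simp add: \<nu>_def)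
    show "convergent (shift_avg \<nu> A)" if "A \<in> sets seq_space" for A
      using \<nu>_tendsto[OF that] by (auto simp: convergent_def)
  qed
  interpret \<nu>: asymptotically_mean_stationary \<nu> by unfold_locales (rule ams_\<nu>)
  show ?thesis
  proof (intro conjI ballI)
    fix A :: "(int \<Rightarrow> 'y) set" assume A: "A \<in> sets seq_space"
    note [measurable] = F_avg_measurable[OF A] G_avg_measurable[OF A]
    let ?\<phi> = "\<lambda>x. inverse (expansion_rate f x) * lim (G_avg f A x)"
    have F_lim: "AE x in \<mu>. F_avg f A x \<longlonglongrightarrow> ?\<phi> x"
      using rate conv[OF A] by eventually_elim (rule F_avg_tendsto)
    have F_lim_mean: "AE x in stationary_mean \<mu>. F_avg f A x \<longlonglongrightarrow> ?\<phi> x"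
      using rate_mean conv_mean[OF A] by eventually_elim (rule F_avg_tendsto)
    have lim_F: "AE x in \<mu>. lim (F_avg f A x) = ?\<phi> x"
      using F_lim by eventually_elim (rule limI)
    have bound: "norm (?\<phi> x) \<le> 1" if "F_avg f A x \<longlonglongrightarrow> ?\<phi> x" for x
      using LIMSEQ_le_const[OF that] LIMSEQ_le_const2[OF that] F_avg_bounds
      by (metis abs_of_nonneg real_norm_def)
    have [measurable]: "(\<lambda>x. lim (F_avg f A x)) \<in> borel_measurable seq_space"
      "(\<lambda>x. lim (G_avg f A x)) \<in> borel_measurable seq_space"
      by (rule borel_measurable_lim_metric; measurable)+
    show int: "integrable \<mu> ?\<phi>"
      by (rule integrable_const_bound[where B = 1]) (use F_lim bound in \<open>auto elim!: eventually_mono\<close>)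
    show "integrable (stationary_mean \<mu>) ?\<phi>"
      by (rule mean.integrable_const_bound[where B = 1]) (use F_lim_mean bound in \<open>auto elim!: eventually_mono\<close>)
    show "integrable \<mu> (\<lambda>x. lim (F_avg f A x))"
      using int lim_F by (subst integrable_cong_AE) auto
    show "AE x in \<mu>. convergent (F_avg f A x)"
      using F_lim by eventually_elim (auto simp: convergent_def)
    show 1: "measure (stationary_mean \<nu>) A = (\<integral>x. lim (F_avg f A x) \<partial>\<mu>)"
      using \<nu>.measure_stationary_mean[OF A] \<nu>_tendsto[OF A] by (simp add: limI)
    show 2: "measure (stationary_mean \<nu>) A = (\<integral>x. ?\<phi> x \<partial>\<mu>)"
      unfolding 1 by (rule integral_cong_AE) (use lim_F in auto)
    show "measure (stationary_mean \<nu>) A = (\<integral>x. ?\<phi> x \<partial>stationary_mean \<mu>)"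
      unfolding 2 by (rule integral_stationary_mean_invariant[symmetric])
        (simp_all add: expansion_rate_shift lim_G_avg_shift)
  qed (use AE_expandable[OF rate] expand_meas ams_\<nu> rate_mean conv conv_mean in auto)
qed

end
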